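(* Let $T>0$ and $x\in\mathbb{R}\times\mathbb{C}$. Assume that the Brownian motion $(B_t)_{t\in[0,T]}$ is given by $B_t=\sum_{k=0}^\infty g_{k,T}(t)\xi_k$. Let $h$ be an $L^1(\Omega,H)$ random variable given by $$h(\omega)(t)=\sum_{k\ge0}\alpha_k(\omega)\,\dot g_{k,T}(t)\quad\text{with, for }k\ge0,\quad\alpha_k(\omega)=\mathscr{A}_k\left((\xi_\ell(\omega))_{\ell\ge0}\right)$$ for some functions $\mathscr{A}_k:\mathbb{R}^{\mathbb{N}}\to\mathbb{R}$. Assume that for all $K\ge0$ and $0\le k\le K$ the random maps $$\mathscr{A}_k^K(\omega):\mathbb{R}^{K+1}\to\mathbb{R},\qquad(z_0,\ldots,z_K)\mapsto\mathscr{A}_k\left(z_0,\ldots,z_K,\xi_{[K+1,\infty)}(\omega)\right)$$ are integrable and with integrable derivative on $\mathbb{R}^{K+1}$ with respect to the standard Gaussian distribution, a.s. in $\xi_{[K+1,\infty)}$, where $\xi_{[K+1,\infty)}(\omega)=(\xi_{K+1}(\omega),\xi_{K+2}(\omega),\ldots)$. Let $$\mathfrak{d}h:=\sum_{k\ge0}\left(\alpha_k\xi_k-\frac{\partial\alpha_k}{\partial\xi_k}\right)$$ and assume that this series converges in $L^1(\Omega,\mathbb{R})$. Then $h$ is in the domain of the adjoint $\delta$ of the Malliavin derivative and $\delta h=\mathfrak{d}h$; that is, for any $\mathcal{C}^1$ function $f:\mathbb{R}\times\mathbb{C}\to\mathbb{R}$, bounded with bounded derivative, $$\mathbb{E}\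left[\left(d_{X_T^x}f,\mathcal{D}X_T^x(h)\right)\right]=\mathbb{E}\left[f(X_T^x)\,\mathfrak{d}h\right].$$
   Context: $H=L^2([0,T],\mathbb{R})$. $(e_k)_{k\ge0}$ is an orthonormal basis of $L^2([0,1],\mathbb{R})$ with $e_0\equiv1$, $g_k(t)=\int_0^te_k(s)\,ds$, and $g_{k,T}(t)=\sqrt T\,g_k(t/T)$ for $t\in[0,T]$, so that $(\dot g_{k,T})_{k\ge0}$ is an orthonormal basis of $H$. $(\xi_k)_{k\ge0}$ is a sequence of independent real $\mathcal{N}(0,1)$ random variables; the series $\sum_kg_{k,T}(t)\xi_k$ converges a.s. uniformly in $t\in[0,T]$ and defines a Brownian motion. $\frac{\partial\alpha_k}{\partial\xi_k}$ denotes the partial derivative of $\mathscr{A}_k$ in its coordinate of index $k$, evaluated at $(\xi_\ell)_{\ell\ge0}$. The kinetic Brownian motion on $\mathbb{R}\times\mathbb{C}$ started at $x=\binom uz$ is $X_t^x=\binom{U_t}{Z_t}$ with $U_t=u+B_t$, $Z_t=z+e^{iu}\int_0^te^{iB_s}ds$ ($\mathbb{C}$ is identified with $\mathbb{R}^2$). Its Malliavin derivative at time $T$ in the (possibly random) direction $h\in H$ is $\mathcal{D}X_T^x(h)=\begin{pmatrix}\int_0^Th(t)\,dt\\ ie^{iu}\int_0^Te^{iB_t}\int_0^th(s)\,ds\,dt\end{pmatrix}$. $(d_yf,w)$ is the differential of $f$ at $y$ in direction $w$. *)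

theory Defs
  imports "HOL-Probability.Probability"
begin

text \<open>
  \<open>L\<^sup>2([0,T],\<real>)\<close>. Elements are functions rather than classes; only their values almost
  everywhere on \<open>[0,T]\<close> enter the notions below.
\<close>

definition L2 :: "real \<Rightarrow> (real \<Rightarrow> real) set" where
  "L2 T = {\<phi>. \<phi> \<in> borel_measurable (lebesgue_on {0..T}) \<and>
              integrable (lebesgue_on {0..T}) (\<lambda>t. (\<phi> t)\<^sup>2)}"

definition L2_inner :: "real \<Rightarrow> (real \<Rightarrow> real) \<Rightarrow> (real \<Rightarrow> real) \<Rightarrow> real" where
  "L2_inner T \<phi> \<psi> = (\<integral>t. \<phi> t * \<psi> t \<partial>lebesgue_on {0..T})"

definition L2_norm :: "real \<Rightarrow> (real \<Rightarrow> real) \<Rightarrow> real" where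
  "L2_norm T \<phi> = sqrt (L2_inner T \<phi> \<phi>)"

definition L2_orthonormal_basis :: "real \<Rightarrow> (nat \<Rightarrow> real \<Rightarrow> real) \<Rightarrow> bool" where
  "L2_orthonormal_basis T e \<longleftrightarrow>
     (\<forall>k. e k \<in> L2 T) \<and>
     (\<forall>j k. L2_inner T (e j) (e k) = (if j = k then 1 else 0)) \<and>
     (\<forall>\<phi>\<in>L2 T. \<forall>\<epsilon>>0. \<exists>n c. L2_norm T (\<lambda>t. \<phi> t - (\<Sum>k<n. c k * e k t)) < \<epsilon>)"

definition L2_sums :: "real \<Rightarrow> (nat \<Rightarrow> real \<Rightarrow> real) \<Rightarrow> (real \<Rightarrow> real) \<Rightarrow> bool" where
  "L2_sums T \<phi> \<psi> \<longleftrightarrow> (\<lambda>n. L2_norm T (\<lambda>t. \<psi> t - (\<Sum>k<n. \<phi> k t))) \<longlonglongrightarrow> 0"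

text \<open>
  \<open>L\<^sup>1(\<Omega>,H)\<close> for \<open>H = L\<^sup>2([0,T],\<real>)\<close>. Every open subset of the separable space \<open>H\<close> is a
  countable union of balls, so a map into \<open>H\<close> is Borel (equivalently, strongly) measurable
  iff its distance to each element of \<open>H\<close> is measurable.
\<close>

definition L1_L2_random_variable :: "'a measure \<Rightarrow> real \<Rightarrow> ('a \<Rightarrow> real \<Rightarrow> real) \<Rightarrow> bool" where
  "L1_L2_random_variable M T h \<longleftrightarrow>
     (\<forall>\<omega>\<in>space M. h \<omega> \<in> L2 T) \<and>
     (\<forall>\<phi>\<in>L2 T. (\<lambda>\<omega>. L2_norm T (\<lambda>t. h \<omega> t - \<phi> t)) \<in> borel_measurable M) \<and>
     integrable M (\<lambda>\<omega>. L2_norm T (h \<omega>))"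

definition L1_sums :: "'a measure \<Rightarrow> (nat \<Rightarrow> 'a \<Rightarrow> real) \<Rightarrow> ('a \<Rightarrow> real) \<Rightarrow> bool" where
  "L1_sums M d D \<longleftrightarrow>
     (\<forall>k. integrable M (d k)) \<and> integrable M D \<and>
     (\<lambda>n. \<integral>\<omega>. \<bar>D \<omega> - (\<Sum>k<n. d k \<omega>)\<bar> \<partial>M) \<longlonglongrightarrow> 0"

definition g :: "(nat \<Rightarrow> real \<Rightarrow> real) \<Rightarrow> nat \<Rightarrow> real \<Rightarrow> real" where
  "g e k t = (\<integral>s. e k s \<partial>lebesgue_on {0..t})"

definition gT :: "(nat \<Rightarrow> real \<Rightarrow> real) \<Rightarrow> real \<Rightarrow> nat \<Rightarrow> real \<Rightarrow> real" where
  "gT e T k t = sqrt T * g e k (t / T)"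

text \<open>The \<open>L\<^sup>2\<close> derivative of \<open>gT e T k\<close>, by the chain rule: \<open>sqrt T / T = 1 / sqrt T\<close>.\<close>

definition gT_dot :: "(nat \<Rightarrow> real \<Rightarrow> real) \<Rightarrow> real \<Rightarrow> nat \<Rightarrow> real \<Rightarrow> real" where
  "gT_dot e T k t = e k (t / T) / sqrt T"

text \<open>Here \<open>b\<close> is a path of the Brownian motion.\<close>

definition kinetic_bm :: "real \<Rightarrow> complex \<Rightarrow> (real \<Rightarrow> real) \<Rightarrow> real \<Rightarrow> real \<times> complex" where
  "kinetic_bm u z b t = (u + b t, z + cis u * (\<integral>s. cis (b s) \<partial>lebesgue_on {0..t}))"

definition malliavin_derivative ::
    "real \<Rightarrow> (real \<Rightarrow> real) \<Rightarrow> real \<Rightarrow> (real \<Rightarrow> real) \<Rightarrow> real \<times> complex" where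
  "malliavin_derivative u b T h =
     (\<integral>t. h t \<partial>lebesgue_on {0..T},
      \<i> * cis u * (\<integral>t. cis (b t) * complex_of_real (\<integral>s. h s \<partial>lebesgue_on {0..t})
                     \<partial>lebesgue_on {0..T}))"

definition partial_deriv :: "nat \<Rightarrow> ((nat \<Rightarrow> real) \<Rightarrow> real) \<Rightarrow> (nat \<Rightarrow> real) \<Rightarrow> real" where
  "partial_deriv j a x = deriv (\<lambda>s. a (x(j := s))) (x j)"

text \<open>
  \<open>\<real>\<^bsup>K+1\<^esup>\<close> is the set \<open>{..K} \<rightarrow>\<^sub>E UNIV\<close> of coordinate vectors indexed by \<open>0, \<dots>, K\<close>; this
  is the space of the following measure.
\<close>

definition std_gaussian :: "nat \<Rightarrow> (nat \<Rightarrow> real) measure" where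
  "std_gaussian K = Pi\<^sub>M {..K} (\<lambda>_. density lborel (\<lambda>x. ennreal (std_normal_density x)))"

text \<open>
  The map \<open>(x\<^sub>0, \<dots>, x\<^sub>K) \<mapsto> a (x\<^sub>0, \<dots>, x\<^sub>K, y\<^sub>K\<^sub>+\<^sub>1, y\<^sub>K\<^sub>+\<^sub>2, \<dots>)\<close>.
\<close>

definition freeze_tail ::
    "nat \<Rightarrow> ((nat \<Rightarrow> real) \<Rightarrow> real) \<Rightarrow> (nat \<Rightarrow> real) \<Rightarrow> (nat \<Rightarrow> real) \<Rightarrow> real" where
  "freeze_tail K a y x = a (\<lambda>l. if l \<le> K then x l else y l)"

text \<open>
  Differentiability is required only along each coordinate, which is weaker than total
  differentiability; the derivative is integrable iff all its coordinates are.
\<close>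

definition gaussian_integrable_with_derivative :: "nat \<Rightarrow> ((nat \<Rightarrow> real) \<Rightarrow> real) \<Rightarrow> bool" where
  "gaussian_integrable_with_derivative K a \<longleftrightarrow>
     integrable (std_gaussian K) a \<and>
     (\<forall>j\<le>K. (\<forall>x \<in> {..K} \<rightarrow>\<^sub>E UNIV. (\<lambda>s. a (x(j := s))) field_differentiable at (x j)) \<and>
            integrable (std_gaussian K) (partial_deriv j a))"

definition C1_bounded ::
    "(real \<times> complex \<Rightarrow> real) \<Rightarrow> (real \<times> complex \<Rightarrow> (real \<times> complex) \<Rightarrow>\<^sub>L real) \<Rightarrow> bool" where
  "C1_bounded f f' \<longleftrightarrow>
     (\<forall>y. (f has_derivative blinfun_apply (f' y)) (at y)) \<and> continuous_on UNIV f' \<and>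
     bounded (range f) \<and> bounded (range f')"

end

theory Submission
  imports Defs
begin

text \<open>
  The law of \<open>\<xi>\<close> is the product \<open>P\<close> of standard normal laws, and \<open>P\<close> is invariant under resampling
  one coordinate. Moving \<open>\<xi>\<^sub>k\<close> translates the Brownian path along \<open>g\<^bsub>k,T\<^esub>\<close>, so
  \<open>\<partial>f(X)/\<partial>\<xi>\<^sub>k = f'(X) (DX (g_dot\<^bsub>k,T\<^esub>))\<close>, and one-dimensional Gaussian integration by parts
  followed by Fubini gives
  \<open>E[f(X) (\<alpha>\<^sub>k \<xi>\<^sub>k - \<partial>\<alpha>\<^sub>k/\<partial>\<xi>\<^sub>k)] = E[\<alpha>\<^sub>k f'(X) (DX (g_dot\<^bsub>k,T\<^esub>))]\<close> for each \<open>k\<close>. Summing over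
  \<open>k < n\<close>, the left side converges by the assumed \<open>L\<^sup>1\<close> convergence, and the right side by dominated
  convergence: \<open>DX\<close> is bounded on \<open>L\<^sup>2\<close> and, by Bessel, the partial sums of \<open>h\<close> have norm at most
  that of \<open>h\<close>.
  The path depends on \<open>\<xi>\<^sub>k\<close> in this way only where the series for \<open>B\<close> converges (\<open>suminf\<close> of a divergent
  series is a constant); convergence for almost every time, almost surely, follows from
  Kolmogorov's maximal inequality and is all that is needed.
\<close>

section \<open>Resampling one coordinate, and convergence of Gaussian series\<close>

text \<open>Over \<open>M\<close>, integrability is at hand for \<open>\<alpha> k\<close>, as a
  Fourier coefficient of \<open>h\<close>, and for the whole term
  \<open>\<alpha> k \<omega> * \<xi> k \<omega> - partial_deriv ...\<close>, as a term of an L1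
  series. The hypothesis on \<open>freeze_tail\<close> holds tail by tail and gives no bound uniform
  in the tail. Hence the two halves of a term are never integrated separately: every step down to
  one dimension carries the difference as a single function. On the line this leaves no decay at
  infinity to quote for the boundary terms; they vanish because an integrable function that has a
  limit at infinity has limit zero. Derivatives exist everywhere along a coordinate but need not be
  continuous, so the fundamental theorem of calculus used is that of the gauge integral. Replacing
  coordinate \<open>k\<close> by an independent \<open>s\<close> in \<open>x(k := s)\<close> plays
  the role of conditioning on all other coordinates, without splitting the sequence space into a
  product.\<close>

lemma integrable_mult_bounded:
  fixes f g :: "'b \<Rightarrow> real"
  assumes f: "integrable M f" and [measurable]: "g \<in> borel_measurable M"
    and bound: "\<And>x. x \<in> space M \<Longrightarrow> \<bar>g x\<bar> \<le> C"
  shows "integrable M (\<lambda>x. f x * g x)"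
proof (rule Bochner_Integration.integrable_bound[OF integrable_mult_left[OF integrable_abs[OF f], of "C"]])
  show "AE x in M. norm (f x * g x) \<le> norm (\<bar>f x\<bar> * C)"
    using bound by (intro AE_I2) (auto simp: abs_mult intro!: mult_left_mono intro: order_trans[OF _ abs_ge_self])
qed (use f in measurable)

section \<open>The canonical Gaussian sequence space\<close>

definition std_normal :: "real measure" where
  "std_normal = density lborel (\<lambda>x. ennreal (std_normal_density x))"

definition gaussian_seq :: "(nat \<Rightarrow> real) measure" where
  "gaussian_seq = Pi\<^sub>M UNIV (\<lambda>_. std_normal)"

lemma sets_std_normal [measurable_cong]: "sets std_normal = sets borel"
  unfolding std_normal_def by simp

lemma space_std_normal [simp]: "space std_normal = UNIV"
  by (simp add: std_normal_def)

lemma sets_gaussian_seq [measurable_cong]: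
  "sets gaussian_seq = sets (Pi\<^sub>M UNIV (\<lambda>_. borel))"
  unfolding gaussian_seq_def by (rule sets_PiM_cong) (auto simp: sets_std_normal)

lemma space_gaussian_seq [simp]: "space gaussian_seq = UNIV"
  by (simp add: gaussian_seq_def space_PiM)

interpretation std_normal: prob_space std_normal
  unfolding std_normal_def by (rule prob_space_normal_density) simp

interpretation gaussian_seq: prob_space gaussian_seq
  unfolding gaussian_seq_def by (intro prob_space_PiM std_normal.prob_space_axioms)

interpretation resample: pair_sigma_finite std_normal gaussian_seq ..

lemma integrable_std_normal_iff:
  fixes f :: "real \<Rightarrow> real"
  shows "f \<in> borel_measurable borel \<Longrightarrow>
    integrable std_normal f \<longleftrightarrow> integrable lborel (\<lambda>s. std_normal_density s * f s)"
  unfolding std_normal_def by (subst integrable_density) auto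

lemma integral_std_normal:
  fixes f :: "real \<Rightarrow> real"
  shows "f \<in> borel_measurable borel \<Longrightarrow>
    (\<integral>s. f s \<partial>std_normal) = (\<integral>s. std_normal_density s * f s \<partial>lborel)"
  unfolding std_normal_def by (subst integral_density) auto

lemma std_normal_moments:
  shows "integrable std_normal (\<lambda>s. s)" "integrable std_normal (\<lambda>s. s\<^sup>2)"
    and "(\<integral>s. s \<partial>std_normal) = 0" "(\<integral>s. s\<^sup>2 \<partial>std_normal) = 1"
  using integrable_std_normal_moment[of 1] integrable_std_normal_moment[of 2]
    integral_std_normal_moment_odd[of 0] integral_std_normal_moment_even[of 1]
  by (simp_all add: integrable_std_normal_iff integral_std_normal fact_numeral)

lemma measurable_resample [measurable]:
  "(\<lambda>(s, x). x(k := s)) \<in> borel \<Otimes>\<^sub>M (Pi\<^sub>M UNIV (\<lambda>_. borel)) \<rightarrow>\<^sub>M Pi\<^sub>M (UNIV :: nat set) (\<lambda>_. borel)"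
  using measurable_add_dim[of k UNIV "\<lambda>_. borel"]
    measurable_compose[OF measurable_pair_swap' measurable_add_dim[of k UNIV "\<lambda>_. borel"]]
  by (simp add: case_prod_beta')

text \<open>Adjoining a coordinate \<open>k\<close> to a product whose index set is already
  \<open>UNIV\<close> overwrites the old value, and the enlarged index set is \<open>UNIV\<close>
  again, so the law of the adjoined family is the original product.\<close>

lemma distr_resample:
  "distr (std_normal \<Otimes>\<^sub>M gaussian_seq) gaussian_seq (\<lambda>(s, x). x(k := s)) = gaussian_seq"
  using distr_pair_PiM_eq_PiM[of UNIV "\<lambda>_. std_normal" k] std_normal.prob_space_axioms
  by (simp add: gaussian_seq_def insert_absorb)

lemma measurable_resample_seq [measurable]:
  "(\<lambda>(s, x). x(k := s)) \<in> std_normal \<Otimes>\<^sub>M gaussian_seq \<rightarrow>\<^sub>M gaussian_seq"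
  using measurable_resample by (simp cong: measurable_cong_sets sets_pair_measure_cong)

text \<open>Push-forward along \<open>distr_resample\<close>, then Fubini with \<open>s\<close>
  integrated first. The inner integral is the conditional expectation given the coordinates other
  than \<open>k\<close>.\<close>

lemma
  fixes G :: "(nat \<Rightarrow> real) \<Rightarrow> real"
  assumes "integrable gaussian_seq G"
  shows integrable_resample: "integrable (std_normal \<Otimes>\<^sub>M gaussian_seq) (\<lambda>(s, x). G (x(k := s)))"
    and AE_integrable_resample: "AE x in gaussian_seq. integrable std_normal (\<lambda>s. G (x(k := s)))"
    and integral_resample: "(\<integral>x. (\<integral>s. G (x(k := s)) \<partial>std_normal) \<partial>gaussian_seq) = (\<integral>x. G x \<partial>gaussian_seq)"
proof -
  have m: "G \<in> borel_measurable gaussian_seq" using assms by auto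
  show *: "integrable (std_normal \<Otimes>\<^sub>M gaussian_seq) (\<lambda>(s, x). G (x(k := s)))"
    using integrable_distr[OF measurable_resample_seq[of k], of G] assms
    unfolding distr_resample by (simp add: case_prod_beta')
  show "AE x in gaussian_seq. integrable std_normal (\<lambda>s. G (x(k := s)))"
    using resample.AE_integrable_snd[OF *] .
  show "(\<integral>x. (\<integral>s. G (x(k := s)) \<partial>std_normal) \<partial>gaussian_seq) = (\<integral>x. G x \<partial>gaussian_seq)"
    using resample.integral_snd[OF *] integral_distr[OF measurable_resample_seq[of k] m]
    unfolding distr_resample by (simp add: case_prod_beta')
qed

lemma distr_gaussian_seq_component: "distr gaussian_seq std_normal (\<lambda>x. x k) = std_normal"
  unfolding gaussian_seq_def by (rule distr_PiM_component) (auto simp: std_normal.prob_space_axioms)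

lemma measurable_gaussian_seq_component [measurable]:
  "(\<lambda>x. x k) \<in> gaussian_seq \<rightarrow>\<^sub>M std_normal" "(\<lambda>x. x k) \<in> borel_measurable gaussian_seq"
  by (simp_all cong: measurable_cong_sets)

lemma
  fixes f :: "real \<Rightarrow> real"
  assumes "integrable std_normal f"
  shows integrable_gaussian_seq_component: "integrable gaussian_seq (\<lambda>x. f (x k))"
    and integral_gaussian_seq_component: "(\<integral>x. f (x k) \<partial>gaussian_seq) = (\<integral>s. f s \<partial>std_normal)"
  using integrable_distr[of "\<lambda>x. x k" gaussian_seq std_normal f] assms
    integral_distr[of "\<lambda>x. x k" gaussian_seq std_normal f]
  by (simp_all add: distr_gaussian_seq_component)

text \<open>The walk stopped at its first exit from \<open>(-\<epsilon>, \<epsilon>)\<close>.\<close>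

fun stopped_sum :: "(nat \<Rightarrow> real) \<Rightarrow> real \<Rightarrow> nat \<Rightarrow> (nat \<Rightarrow> real) \<Rightarrow> real" where
  "stopped_sum c \<epsilon> 0 x = 0"
| "stopped_sum c \<epsilon> (Suc n) x =
     stopped_sum c \<epsilon> n x + (if \<bar>stopped_sum c \<epsilon> n x\<bar> < \<epsilon> then c n * x n else 0)"

text \<open>The stopped walk either still coincides with the free walk or has already left the
  strip, and after leaving it never moves again. So an exit of the free walk at any time up to
  \<open>n\<close> is still visible at time \<open>n\<close>.\<close>

lemma stopped_sum_exit:
  assumes "0 < \<epsilon>" "j \<le> n" "\<epsilon> \<le> \<bar>\<Sum>k<j. c k * x k\<bar>"
  shows "\<epsilon> \<le> \<bar>stopped_sum c \<epsilon> n x\<bar>"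
proof -
  have "stopped_sum c \<epsilon> n x = (\<Sum>k<n. c k * x k) \<or> \<epsilon> \<le> \<bar>stopped_sum c \<epsilon> n x\<bar>" for n
    by (induction n) auto
  moreover have "\<epsilon> \<le> \<bar>stopped_sum c \<epsilon> n x\<bar>" if "\<epsilon> \<le> \<bar>stopped_sum c \<epsilon> j x\<bar>"
    using \<open>j \<le> n\<close> by (induction n rule: dec_induct) (use that in auto)
  ultimately show ?thesis using assms(3) by metis
qed

text \<open>Predictability: up to time \<open>n\<close> only the coordinates below \<open>n\<close>
  have been read. This makes the next increment orthogonal to the past.\<close>

lemma stopped_sum_upd: "n \<le> k \<Longrightarrow> stopped_sum c \<epsilon> n (x(k := s)) = stopped_sum c \<epsilon> n x"
  by (induction n) auto

lemma measurable_stopped_sum [measurable]: "stopped_sum c \<epsilon> n \<in> borel_measurable gaussian_seq"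
  by (induction n) (simp_all add: stopped_sum.simps[abs_def])

text \<open>The stopped walk is a square-integrable martingale: the increment is
  \<open>J x * x n\<close> with \<open>J\<close> predictable, so the cross term has mean zero and
  each step adds at most \<open>(c n)\<^sup>2\<close>.\<close>

lemma stopped_sum_second_moment:
  "integrable gaussian_seq (\<lambda>x. (stopped_sum c \<epsilon> n x)\<^sup>2) \<and>
   (\<integral>x. (stopped_sum c \<epsilon> n x)\<^sup>2 \<partial>gaussian_seq) \<le> (\<Sum>k<n. (c k)\<^sup>2)"
proof (induction n)
  case (Suc n)
  define Y where "Y = stopped_sum c \<epsilon> n"
  define J where "J x = (if \<bar>Y x\<bar> < \<epsilon> then c n else 0)" for x
  have [measurable]: "Y \<in> borel_measurable gaussian_seq" "J \<in> borel_measurable gaussian_seq"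
    unfolding J_def[abs_def] Y_def by measurable
  have upd: "Y (x(n := s)) = Y x" "J (x(n := s)) = J x" for x s
    by (simp_all add: Y_def J_def stopped_sum_upd)
  have Jc: "(J x)\<^sup>2 \<le> (c n)\<^sup>2" for x by (simp add: J_def)
  have Y2: "integrable gaussian_seq (\<lambda>x. (Y x)\<^sup>2)" using Suc by (simp add: Y_def)
  have n2: "integrable gaussian_seq (\<lambda>x. (x n)\<^sup>2)"
    by (rule integrable_gaussian_seq_component[OF std_normal_moments(2)])
  have J2: "integrable gaussian_seq (\<lambda>x. (J x)\<^sup>2 * (x n)\<^sup>2)"
  proof (rule Bochner_Integration.integrable_bound[OF integrable_mult_right[OF n2, of "(c n)\<^sup>2"]])
    show "AE x in gaussian_seq. norm ((J x)\<^sup>2 * (x n)\<^sup>2) \<le> norm ((c n)\<^sup>2 * (x n)\<^sup>2)"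
      using Jc by (auto intro!: AE_I2 mult_right_mono)
  qed simp
  have YJ: "integrable gaussian_seq (\<lambda>x. (Y x * J x) * x n)"
  proof (rule Bochner_Integration.integrable_bound[OF Bochner_Integration.integrable_add[OF Y2 J2]])
    have "\<bar>a * b * d\<bar> \<le> \<bar>a\<^sup>2 + b\<^sup>2 * d\<^sup>2\<bar>" for a b d :: real
    proof -
      have "2 * \<bar>a * (b * d)\<bar> \<le> a\<^sup>2 + (b * d)\<^sup>2"
        using sum_squares_bound[of "\<bar>a\<bar>" "\<bar>b * d\<bar>"] by (simp add: abs_mult power_mult_distrib mult.assoc)
      moreover have "0 \<le> \<bar>a * (b * d)\<bar>" by simp
      ultimately have "\<bar>a * (b * d)\<bar> \<le> a\<^sup>2 + (b * d)\<^sup>2" by linarith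
      then show ?thesis by (simp add: power_mult_distrib mult.assoc)
    qed
    then show "AE x in gaussian_seq. norm (Y x * J x * x n) \<le> norm ((Y x)\<^sup>2 + (J x)\<^sup>2 * (x n)\<^sup>2)"
      by (auto intro!: AE_I2)
  qed simp
  \<comment> \<open>Coordinate \<open>n\<close> is integrated out before the others;
    \<open>Y\<close> and \<open>J\<close> do not see it, and its mean is zero.\<close>
  have "(\<integral>x. (Y x * J x) * x n \<partial>gaussian_seq) = 0"
    using integral_resample[OF YJ, of n] by (simp add: upd std_normal_moments)
  moreover have "(\<integral>x. (J x)\<^sup>2 * (x n)\<^sup>2 \<partial>gaussian_seq) \<le> (\<integral>x. (c n)\<^sup>2 * (x n)\<^sup>2 \<partial>gaussian_seq)"
    using J2 n2 Jc by (intro integral_mono) (auto intro!: mult_right_mono)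
  moreover have "(\<integral>x. (c n)\<^sup>2 * (x n)\<^sup>2 \<partial>gaussian_seq) = (c n)\<^sup>2"
    using integral_gaussian_seq_component[OF std_normal_moments(2), of n] std_normal_moments(4) by simp
  ultimately have YJ0: "(\<integral>x. (Y x * J x) * x n \<partial>gaussian_seq) = 0"
    and le: "(\<integral>x. (J x)\<^sup>2 * (x n)\<^sup>2 \<partial>gaussian_seq) \<le> (c n)\<^sup>2" by linarith+
  have *: "(stopped_sum c \<epsilon> (Suc n) x)\<^sup>2 = (Y x)\<^sup>2 + 2 * ((Y x * J x) * x n) + (J x)\<^sup>2 * (x n)\<^sup>2" for x
    by (simp add: Y_def J_def power2_eq_square algebra_simps)
  have "(\<integral>x. (stopped_sum c \<epsilon> (Suc n) x)\<^sup>2 \<partial>gaussian_seq)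
     = (\<integral>x. (Y x)\<^sup>2 \<partial>gaussian_seq) + (\<integral>x. (J x)\<^sup>2 * (x n)\<^sup>2 \<partial>gaussian_seq)"
    unfolding * using Y2 J2 YJ YJ0 by simp
  moreover have "integrable gaussian_seq (\<lambda>x. (stopped_sum c \<epsilon> (Suc n) x)\<^sup>2)"
    unfolding * using Y2 J2 YJ by simp
  ultimately show ?case
    using Suc le by (simp add: Y_def[symmetric] del: stopped_sum.simps)
qed simp

text \<open>An exit at some time up to \<open>n\<close> forces the stopped walk to be large at time
  \<open>n\<close>, so Markov's inequality for its square at this single time covers the whole
  maximum.\<close>

lemma Kolmogorov_maximal_inequality:
  assumes "0 < \<epsilon>"
  shows "measure gaussian_seq {x. \<exists>j\<le>n. \<epsilon> \<le> \<bar>\<Sum>k<j. c k * x k\<bar>} \<le> (\<Sum>k<n. (c k)\<^sup>2) / \<epsilon>\<^sup>2"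
proof -
  have "measure gaussian_seq {x. \<exists>j\<le>n. \<epsilon> \<le> \<bar>\<Sum>k<j. c k * x k\<bar>}
     \<le> measure gaussian_seq {x \<in> space gaussian_seq. \<epsilon>\<^sup>2 \<le> (stopped_sum c \<epsilon> n x)\<^sup>2}"
  proof (rule gaussian_seq.finite_measure_mono)
    show "{x. \<exists>j\<le>n. \<epsilon> \<le> \<bar>\<Sum>k<j. c k * x k\<bar>} \<subseteq> {x \<in> space gaussian_seq. \<epsilon>\<^sup>2 \<le> (stopped_sum c \<epsilon> n x)\<^sup>2}"
      using stopped_sum_exit[OF assms] assms by (auto simp flip: abs_le_square_iff)
    show "{x \<in> space gaussian_seq. \<epsilon>\<^sup>2 \<le> (stopped_sum c \<epsilon> n x)\<^sup>2} \<in> sets gaussian_seq" by measurable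
  qed
  also have "\<dots> \<le> (\<integral>x. (stopped_sum c \<epsilon> n x)\<^sup>2 \<partial>gaussian_seq) / \<epsilon>\<^sup>2"
    using stopped_sum_second_moment assms by (intro integral_Markov_inequality_measure[of _ _ "{}"]) auto
  also have "\<dots> \<le> (\<Sum>k<n. (c k)\<^sup>2) / \<epsilon>\<^sup>2"
    using stopped_sum_second_moment by (intro divide_right_mono) auto
  finally show ?thesis .
qed

text \<open>The maximal inequality applied to coefficients set to zero below \<open>m\<close>,
  followed by continuity of the measure along the increasing horizons \<open>n\<close>.\<close>

lemma Kolmogorov_tail:
  assumes "summable (\<lambda>k. (c k)\<^sup>2)" "0 < \<epsilon>"
  shows "measure gaussian_seq {x. \<exists>j\<ge>m. \<epsilon> \<le> \<bar>\<Sum>k=m..<j. c k * x k\<bar>} \<le> (\<Sum>k. (c (k + m))\<^sup>2) / \<epsilon>\<^sup>2"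
proof -
  define E where "E n = {x. \<exists>j\<le>n. \<epsilon> \<le> \<bar>\<Sum>k<j. (if k < m then 0 else c k) * x k\<bar>}" for n
  have E[measurable]: "E n \<in> sets gaussian_seq" for n
  proof -
    have "{x \<in> space gaussian_seq. \<exists>j\<le>n. \<epsilon> \<le> \<bar>\<Sum>k<j. (if k < m then 0 else c k) * x k\<bar>} \<in> sets gaussian_seq"
      by measurable
    then show ?thesis by (simp add: E_def)
  qed
  have sum_eq: "(\<Sum>k<j. (if k < m then 0 else c k) * y k) = (\<Sum>k=m..<j. c k * y k)" for j and y :: "nat \<Rightarrow> real"
    by (rule sum.mono_neutral_cong_right) auto
  have "(\<Union>n. E n) = {x. \<exists>j\<ge>m. \<epsilon> \<le> \<bar>\<Sum>k=m..<j. c k * x k\<bar>}"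
  proof -
    \<comment> \<open>For \<open>j < m\<close> the sum is empty, and \<open>0 < \<epsilon>\<close>
      excludes it.\<close>
    have "j \<ge> m" if "\<epsilon> \<le> \<bar>\<Sum>k=m..<j. c k * x k\<bar>" for j and x :: "nat \<Rightarrow> real"
      using that \<open>0 < \<epsilon>\<close> by (cases "m \<le> j") auto
    then have "{x. \<exists>j\<ge>m. \<epsilon> \<le> \<bar>\<Sum>k=m..<j. c k * x k\<bar>} = {x. \<exists>j. \<epsilon> \<le> \<bar>\<Sum>k=m..<j. c k * x k\<bar>}"
      by blast
    then show ?thesis unfolding E_def sum_eq by blast
  qed
  moreover have "(\<lambda>n. measure gaussian_seq (E n)) \<longlonglongrightarrow> measure gaussian_seq (\<Union>n. E n)"
  proof (rule gaussian_seq.finite_Lim_measure_incseq)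
    show "range E \<subseteq> sets gaussian_seq" using E by auto
    show "incseq E" unfolding incseq_def E_def by (blast intro: order_trans)
  qed
  moreover have "measure gaussian_seq (E n) \<le> (\<Sum>k. (c (k + m))\<^sup>2) / \<epsilon>\<^sup>2" for n
  proof -
    have "measure gaussian_seq (E n) \<le> (\<Sum>k<n. (if k < m then 0 else c k)\<^sup>2) / \<epsilon>\<^sup>2"
      unfolding E_def by (rule Kolmogorov_maximal_inequality[OF \<open>0 < \<epsilon>\<close>])
    also have "(\<Sum>k<n. (if k < m then 0 else c k)\<^sup>2) = (\<Sum>k=m..<n. (c k)\<^sup>2)"
      by (rule sum.mono_neutral_cong_right) auto
    also have "\<dots> = (\<Sum>k<n - m. (c (k + m))\<^sup>2)"
      using sum.shift_bounds_nat_ivl[of "\<lambda>k. (c k)\<^sup>2" 0 m "n - m"] by (cases "m \<le> n") (auto simp: atLeast0LessThan)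
    also have "\<dots> \<le> (\<Sum>k. (c (k + m))\<^sup>2)"
      using assms(1) by (intro sum_le_suminf) (auto simp: summable_iff_shift[of "\<lambda>k. (c k)\<^sup>2"])
    finally show ?thesis by (simp add: divide_right_mono)
  qed
  ultimately show ?thesis by (auto intro: LIMSEQ_le_const2)
qed

text \<open>Cauchy's criterion. The event that, for every \<open>m\<close>, the sums started at
  \<open>m\<close> leave a strip of width given by \<open>\<epsilon>\<close> is null, since its
  probability is below every tail of the convergent series of squares. Strips
  \<open>inverse (Suc p)\<close> reduce the criterion to countably many null sets.\<close>

lemma AE_summable_gaussian_series:
  assumes "summable (\<lambda>k. (c k)\<^sup>2)"
  shows "AE x in gaussian_seq. summable (\<lambda>k. c k * x k)"
proof -
  have "AE x in gaussian_seq. \<exists>m. \<forall>j\<ge>m. \<bar>\<Sum>k=m..<j. c k * x k\<bar> < inverse (Suc p)" for p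
  proof -
    define \<epsilon> where "\<epsilon> = inverse (real (Suc p))"
    have "\<epsilon> > 0" by (simp add: \<epsilon>_def)
    define D where "D m = {x. \<exists>j\<ge>m. \<epsilon> \<le> \<bar>\<Sum>k=m..<j. c k * x k\<bar>}" for m
    have D[measurable]: "D m \<in> sets gaussian_seq" for m
    proof -
      have "{x \<in> space gaussian_seq. \<exists>j\<ge>m. \<epsilon> \<le> \<bar>\<Sum>k=m..<j. c k * x k\<bar>} \<in> sets gaussian_seq"
        by measurable
      then show ?thesis by (simp add: D_def)
    qed
    have "(\<lambda>m. (\<Sum>k. (c (k + m))\<^sup>2) / \<epsilon>\<^sup>2) \<longlonglongrightarrow> 0 / \<epsilon>\<^sup>2"
      using suminf_exist_split2[OF assms] by (intro tendsto_divide tendsto_const) (use \<open>\<epsilon> > 0\<close> in auto)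
    then have "measure gaussian_seq (\<Inter>m. D m) \<le> 0"
    proof (intro LIMSEQ_le_const, simp, intro exI allI impI)
      fix m
      have "measure gaussian_seq (\<Inter>m. D m) \<le> measure gaussian_seq (D m)"
        by (rule gaussian_seq.finite_measure_mono) auto
      also have "\<dots> \<le> (\<Sum>k. (c (k + m))\<^sup>2) / \<epsilon>\<^sup>2"
        unfolding D_def by (rule Kolmogorov_tail[OF assms \<open>\<epsilon> > 0\<close>])
      finally show "measure gaussian_seq (\<Inter>m. D m) \<le> (\<Sum>k. (c (k + m))\<^sup>2) / \<epsilon>\<^sup>2" .
    qed
    then have "(\<Inter>m. D m) \<in> null_sets gaussian_seq"
      by (auto simp: null_sets_def gaussian_seq.emeasure_eq_measure measure_le_0_iff)
    then have "AE x in gaussian_seq. x \<notin> (\<Inter>m. D m)" by (rule AE_not_in)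
    then show ?thesis
    proof eventually_elim
      case (elim x)
      then obtain m where "x \<notin> D m" by blast
      then show ?case unfolding D_def \<epsilon>_def by (intro exI[of _ m]) (simp add: not_le imp_conv_disj)
    qed
  qed
  then have "AE x in gaussian_seq. \<forall>p. \<exists>m. \<forall>j\<ge>m. \<bar>\<Sum>k=m..<j. c k * x k\<bar> < inverse (Suc p)"
    by (simp add: AE_all_countable)
  then show ?thesis
  proof eventually_elim
    case (elim x)
    have "Cauchy (\<lambda>n. \<Sum>k<n. c k * x k)"
    proof (rule CauchyI')
      fix e :: real assume "0 < e"
      then obtain p where p: "inverse (Suc p) < e / 2" using reals_Archimedean[of "e/2"] by auto
      obtain m where m: "\<And>j. j \<ge> m \<Longrightarrow> \<bar>\<Sum>k=m..<j. c k * x k\<bar> < inverse (Suc p)" using elim by blast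
      have split: "(\<Sum>k<j. c k * x k) = (\<Sum>k<m. c k * x k) + (\<Sum>k=m..<j. c k * x k)" if "j \<ge> m" for j
        using sum.atLeastLessThan_concat[of 0 m j "\<lambda>k. c k * x k"] that by (simp add: atLeast0LessThan)
      have "\<bar>(\<Sum>k<i. c k * x k) - (\<Sum>k<j. c k * x k)\<bar> < e" if "i \<ge> m" "j \<ge> m" for i j
        using m[OF that(1)] m[OF that(2)] p split[OF that(1)] split[OF that(2)] by linarith
      then show "\<exists>M. \<forall>i\<ge>M. \<forall>n>i. dist (\<Sum>k<i. c k * x k) (\<Sum>k<n. c k * x k) < e"
        by (intro exI[of _ m]) (auto simp: dist_real_def)
    qed
    then show ?case by (simp add: summable_iff_convergent Cauchy_convergent_iff)
  qed
qed

section \<open>Gaussian integration by parts on the line\<close>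

text \<open>With a nonzero limit, the absolute value would stay above half of
  \<open>\<bar>l\<bar>\<close> on intervals of every length \<open>n\<close>.\<close>

lemma integrable_tendsto_at_top_imp_zero:
  fixes \<psi> :: "real \<Rightarrow> real"
  assumes "integrable lborel \<psi>" "(\<psi> \<longlongrightarrow> l) at_top"
  shows "l = 0"
proof (rule ccontr)
  assume "l \<noteq> 0"
  then have "\<bar>l\<bar> / 2 < \<bar>l\<bar>" by simp
  with tendsto_rabs[OF assms(2)] have "eventually (\<lambda>s. \<bar>l\<bar> / 2 < \<bar>\<psi> s\<bar>) at_top"
    by (rule order_tendstoD)
  then obtain b where b: "\<And>s. b \<le> s \<Longrightarrow> \<bar>l\<bar> / 2 < \<bar>\<psi> s\<bar>"
    by (auto simp: eventually_at_top_linorder)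
  have "real n * (\<bar>l\<bar> / 2) \<le> (\<integral>s. \<bar>\<psi> s\<bar> \<partial>lborel)" for n
  proof -
    have "(\<integral>s. indicator {b..b + real n} s * (\<bar>l\<bar> / 2) \<partial>lborel) \<le> (\<integral>s. \<bar>\<psi> s\<bar> \<partial>lborel)"
      using assms(1) b by (intro integral_mono) (auto split: split_indicator intro: less_imp_le)
    then show ?thesis by simp
  qed
  then have "real n \<le> (\<integral>s. \<bar>\<psi> s\<bar> \<partial>lborel) / (\<bar>l\<bar> / 2)" for n
    using \<open>l \<noteq> 0\<close> by (subst pos_le_divide_eq) auto
  then show False using reals_Archimedean2 by (metis not_le)
qed

text \<open>No decay of \<open>\<psi>\<close> is assumed. The boundary term
  \<open>\<psi> b - \<psi> (- b)\<close> converges to the integral of \<open>\<psi>'\<close> and is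
  at the same time an integrable function of \<open>b\<close>, so its limit can only be
  zero.\<close>

lemma integral_deriv_eq_zero:
  fixes \<psi> \<psi>' :: "real \<Rightarrow> real"
  assumes deriv: "\<And>s. (\<psi> has_field_derivative \<psi>' s) (at s)"
    and int: "integrable lborel \<psi>" "integrable lborel \<psi>'"
  shows "(\<integral>s. \<psi>' s \<partial>lborel) = 0"
proof -
  have FTC: "\<psi> b - \<psi> a = (LINT s:{a..b}|lborel. \<psi>' s)" if "a \<le> b" for a b
  proof -
    \<comment> \<open>The gauge integral needs differentiability everywhere and no continuity of
      \<open>\<psi>'\<close>; it agrees with the Lebesgue integral because \<open>\<psi>'\<close> is
      integrable.\<close>
    have "(\<psi>' has_integral \<psi> b - \<psi> a) {a..b}"
      using that deriv by (intro fundamental_theorem_of_calculus)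
        (auto simp: has_real_derivative_iff_has_vector_derivative[symmetric] intro: has_field_derivative_at_within)
    moreover have "set_integrable lborel {a..b} \<psi>'"
      using int(2) unfolding set_integrable_def by (rule integrable_mult_indicator[rotated]) simp
    ultimately show ?thesis
      using set_borel_integral_eq_integral[of "{a..b}" \<psi>'] by (simp add: integral_unique)
  qed
  have "((\<lambda>b. \<integral>s. indicator {-b..b} s *\<^sub>R \<psi>' s \<partial>lborel) \<longlongrightarrow> (\<integral>s. \<psi>' s \<partial>lborel)) at_top"
  proof (rule tendsto_at_topI_sequentially)
    fix X :: "nat \<Rightarrow> real" assume X: "filterlim X at_top sequentially"
    show "(\<lambda>n. \<integral>s. indicator {-X n..X n} s *\<^sub>R \<psi>' s \<partial>lborel) \<longlonglongrightarrow> (\<integral>s. \<psi>' s \<partial>lborel)"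
    proof (rule integral_dominated_convergence[where w="\<lambda>s. \<bar>\<psi>' s\<bar>"])
      have "(\<lambda>n. indicator {-X n..X n} s *\<^sub>R \<psi>' s) \<longlonglongrightarrow> \<psi>' s" for s
      proof (rule tendsto_eventually)
        show "\<forall>\<^sub>F n in sequentially. indicator {- X n..X n} s *\<^sub>R \<psi>' s = \<psi>' s"
          using filterlim_at_top_dense[THEN iffD1, OF X, rule_format, of "\<bar>s\<bar>"]
          by eventually_elim (auto simp: indicator_def)
      qed
      then show "AE s in lborel. (\<lambda>n. indicator {-X n..X n} s *\<^sub>R \<psi>' s) \<longlonglongrightarrow> \<psi>' s" by simp
    qed (use int(2) in \<open>auto simp: indicator_def\<close>)
  qed
  then have "((\<lambda>b. \<psi> b - \<psi> (- b)) \<longlongrightarrow> (\<integral>s. \<psi>' s \<partial>lborel)) at_top"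
    by (rule Lim_transform_eventually)
      (auto simp: FTC set_lebesgue_integral_def eventually_at_top_linorder intro!: exI[of _ 0])
  \<comment> \<open>Reflection preserves Lebesgue measure.\<close>
  moreover have "integrable lborel (\<lambda>s. \<psi> s - \<psi> (- s))"
    using int(1) lborel_integrable_real_affine_iff[of "-1" \<psi> 0] by simp
  ultimately show ?thesis
    using integrable_tendsto_at_top_imp_zero by blast
qed

lemma std_normal_density_has_derivative:
  "(std_normal_density has_field_derivative - s * std_normal_density s) (at s)"
proof -
  define c :: real where "c = 1 / sqrt (2 * pi)"
  have "((\<lambda>s. c * exp (- s\<^sup>2 / 2)) has_field_derivative c * (exp (- s\<^sup>2 / 2) * (- s))) (at s)"
    by (auto intro!: derivative_eq_intros)
  then show ?thesis by (simp add: std_normal_density_def[abs_def] c_def mult_ac)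
qed

text \<open>The derivative of \<open>a \<cdot> \<Phi> \<cdot> std_normal_density\<close> involves \<open>a'\<close> only through
  \<open>a s * s - a' s\<close>.\<close>

lemma std_normal_integration_by_parts:
  fixes a a' \<Phi> \<Phi>' :: "real \<Rightarrow> real"
  assumes a: "\<And>s. (a has_field_derivative a' s) (at s)"
    and \<Phi>: "\<And>s. (\<Phi> has_field_derivative \<Phi>' s) (at s)"
    and bound: "\<And>s. \<bar>\<Phi> s\<bar> \<le> C" "\<And>s. \<bar>\<Phi>' s\<bar> \<le> C"
    and [measurable]: "\<Phi>' \<in> borel_measurable borel"
    and int: "integrable std_normal a" "integrable std_normal (\<lambda>s. a s * s - a' s)"
  shows "(\<integral>s. (a s * s - a' s) * \<Phi> s - a s * \<Phi>' s \<partial>std_normal) = 0"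
proof -
  have "continuous_on UNIV a" "continuous_on UNIV \<Phi>"
    using a \<Phi> by (auto intro!: continuous_at_imp_continuous_on DERIV_isCont)
  then have [measurable]: "a \<in> borel_measurable borel" "\<Phi> \<in> borel_measurable borel"
    by (auto intro: borel_measurable_continuous_onI)
  have [measurable]: "(\<lambda>s. a s * s - a' s) \<in> borel_measurable borel"
    using borel_measurable_integrable[OF int(2)] by (simp add: std_normal_def)
  \<comment> \<open>Measurability of \<open>a'\<close> is recovered from that of the difference and
    of \<open>a\<close>, which is continuous.\<close>
  then have "(\<lambda>s. a s * s - (a s * s - a' s)) \<in> borel_measurable borel" by measurable
  then have [measurable]: "a' \<in> borel_measurable borel" by simp
  have aint: "integrable lborel (\<lambda>s. std_normal_density s * a s)"
    and qint: "integrable lborel (\<lambda>s. std_normal_density s * (a s * s - a' s))"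
    using int by (simp_all only: integrable_std_normal_iff \<open>a \<in> borel_measurable borel\<close>
        \<open>(\<lambda>s. a s * s - a' s) \<in> borel_measurable borel\<close>)
  define \<psi> where "\<psi> s = std_normal_density s * a s * \<Phi> s" for s
  define \<psi>' where "\<psi>' s = std_normal_density s * a s * \<Phi>' s - std_normal_density s * (a s * s - a' s) * \<Phi> s" for s
  have "(\<psi> has_field_derivative \<psi>' s) (at s)" for s
    unfolding \<psi>_def[abs_def] \<psi>'_def
    by (rule derivative_eq_intros std_normal_density_has_derivative a \<Phi> refl)+ (simp add: algebra_simps)
  moreover have "integrable lborel \<psi>"
    unfolding \<psi>_def[abs_def] by (rule integrable_mult_bounded[OF aint]) (use bound in auto)
  moreover have "integrable lborel \<psi>'"
    unfolding \<psi>'_def[abs_def]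
    by (intro Bochner_Integration.integrable_diff integrable_mult_bounded[OF aint] integrable_mult_bounded[OF qint])
      (use bound in auto)
  ultimately have "(\<integral>s. \<psi>' s \<partial>lborel) = 0"
    by (rule integral_deriv_eq_zero)
  moreover have "(\<integral>s. (a s * s - a' s) * \<Phi> s - a s * \<Phi>' s \<partial>std_normal) = (\<integral>s. - \<psi>' s \<partial>lborel)"
    by (subst integral_std_normal) (simp_all add: \<psi>'_def algebra_simps)
  ultimately show ?thesis by simp
qed

section \<open>Orthonormal families in square-integrable functions\<close>

interpretation lebesgue_on_Icc: finite_measure "lebesgue_on {a..b}" for a b :: real
  by (rule finite_measure_lebesgue_on) simp

lemma measure_lebesgue_on_Icc [simp]: "measure (lebesgue_on {0..T}) {0..T} = max 0 (T::real)"
  by (simp add: measure_restrict_space)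

lemma L2_integrable_mult:
  assumes "\<phi> \<in> L2 T" "\<psi> \<in> L2 T"
  shows "integrable (lebesgue_on {0..T}) (\<lambda>t. \<phi> t * \<psi> t)"
proof (rule Bochner_Integration.integrable_bound)
  show "integrable (lebesgue_on {0..T}) (\<lambda>t. (\<phi> t)\<^sup>2 + (\<psi> t)\<^sup>2)"
    using assms by (auto simp: L2_def)
  have "\<bar>a * b\<bar> \<le> \<bar>a\<^sup>2 + b\<^sup>2\<bar>" for a b :: real
  proof -
    have "2 * (\<bar>a\<bar> * \<bar>b\<bar>) \<le> a\<^sup>2 + b\<^sup>2"
      using sum_squares_bound[of "\<bar>a\<bar>" "\<bar>b\<bar>"] by (simp add: mult.assoc)
    moreover have "0 \<le> \<bar>a\<bar> * \<bar>b\<bar>" by simp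
    ultimately show ?thesis unfolding abs_mult by linarith
  qed
  then show "AE t in lebesgue_on {0..T}. norm (\<phi> t * \<psi> t) \<le> norm ((\<phi> t)\<^sup>2 + (\<psi> t)\<^sup>2)" by auto
qed (use assms in \<open>auto simp: L2_def\<close>)

lemma L2_integrable: "\<phi> \<in> L2 T \<Longrightarrow> integrable (lebesgue_on {0..T}) \<phi>"
  by (auto simp: L2_def intro: lebesgue_on_Icc.square_integrable_imp_integrable)

lemma L2_add [intro]: "\<phi> \<in> L2 T \<Longrightarrow> \<psi> \<in> L2 T \<Longrightarrow> (\<lambda>t. \<phi> t + \<psi> t) \<in> L2 T"
  using L2_integrable_mult[of \<phi> T \<psi>] by (auto simp: L2_def power2_sum mult.assoc)

lemma L2_cmult [intro]: "\<phi> \<in> L2 T \<Longrightarrow> (\<lambda>t. c * \<phi> t) \<in> L2 T"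
  by (auto simp: L2_def power_mult_distrib)

lemma L2_diff [intro]: "\<phi> \<in> L2 T \<Longrightarrow> \<psi> \<in> L2 T \<Longrightarrow> (\<lambda>t. \<phi> t - \<psi> t) \<in> L2 T"
  using L2_add[of \<phi> T "\<lambda>t. - 1 * \<psi> t"] L2_cmult[of \<psi> T "-1"] by simp

lemma L2_sum [intro]: "(\<And>k. k \<in> I \<Longrightarrow> \<phi> k \<in> L2 T) \<Longrightarrow> (\<lambda>t. \<Sum>k\<in>I. \<phi> k t) \<in> L2 T"
proof (induction I rule: infinite_finite_induct)
  case (insert k I)
  then show ?case using L2_add[of "\<phi> k" T "\<lambda>t. \<Sum>k\<in>I. \<phi> k t"] by simp
qed (auto simp: L2_def)

lemma L2_indicator [intro]: "S \<in> sets lebesgue \<Longrightarrow> (\<lambda>t. indicator S t) \<in> L2 T"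
proof -
  assume S: "S \<in> sets lebesgue"
  then have [measurable]: "(\<lambda>t. indicator S t :: real) \<in> borel_measurable (lebesgue_on {0..T})"
    by (intro measurable_restrict_space1 borel_measurable_indicator)
  then have "integrable (lebesgue_on {0..T}) (\<lambda>t. (indicator S t :: real)\<^sup>2)"
    by (intro lebesgue_on_Icc.integrable_const_bound[where B=1]) (auto split: split_indicator)
  then show ?thesis by (simp add: L2_def)
qed

section \<open>Inner product and norm on square-integrable functions\<close>

lemma L2_inner_commute: "L2_inner T \<phi> \<psi> = L2_inner T \<psi> \<phi>"
  by (simp add: L2_inner_def mult.commute)

lemma L2_inner_cmult_left: "L2_inner T (\<lambda>t. c * \<phi> t) \<psi> = c * L2_inner T \<phi> \<psi>"
  by (simp add: L2_inner_def mult.assoc)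

lemma L2_inner_diff_left: "\<phi> \<in> L2 T \<Longrightarrow> \<phi>' \<in> L2 T \<Longrightarrow> \<psi> \<in> L2 T \<Longrightarrow>
    L2_inner T (\<lambda>t. \<phi> t - \<phi>' t) \<psi> = L2_inner T \<phi> \<psi> - L2_inner T \<phi>' \<psi>"
  by (simp add: L2_inner_def left_diff_distrib L2_integrable_mult)

lemma L2_inner_sum_left: "(\<And>k. k \<in> I \<Longrightarrow> \<phi> k \<in> L2 T) \<Longrightarrow> \<psi> \<in> L2 T \<Longrightarrow>
    L2_inner T (\<lambda>t. \<Sum>k\<in>I. \<phi> k t) \<psi> = (\<Sum>k\<in>I. L2_inner T (\<phi> k) \<psi>)"
  by (simp add: L2_inner_def sum_distrib_right L2_integrable_mult)

lemma L2_inner_self_nonneg [simp]: "0 \<le> L2_inner T \<phi> \<phi>"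
  by (simp add: L2_inner_def)

lemma L2_norm_nonneg [simp]: "0 \<le> L2_norm T \<phi>"
  by (simp add: L2_norm_def)

lemma L2_norm_power2: "(L2_norm T \<phi>)\<^sup>2 = L2_inner T \<phi> \<phi>"
  by (simp add: L2_norm_def)

lemma L2_norm_diff_power2:
  assumes "\<phi> \<in> L2 T" "\<psi> \<in> L2 T"
  shows "(L2_norm T (\<lambda>t. \<phi> t - \<psi> t))\<^sup>2 = (L2_norm T \<phi>)\<^sup>2 - 2 * L2_inner T \<phi> \<psi> + (L2_norm T \<psi>)\<^sup>2"
proof -
  have "(\<phi> t - \<psi> t) * (\<phi> t - \<psi> t) = \<phi> t * \<phi> t - 2 * (\<phi> t * \<psi> t) + \<psi> t * \<psi> t" for t
    by (simp add: algebra_simps)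
  then show ?thesis
    using L2_integrable_mult[of \<phi> T \<phi>] L2_integrable_mult[of \<phi> T \<psi>] L2_integrable_mult[of \<psi> T \<psi>] assms
    by (simp add: L2_norm_power2 L2_inner_def)
qed

text \<open>The squared norm of \<open>\<phi> - s * \<psi>\<close> is a nonnegative quadratic in
  \<open>s\<close>, evaluated at its minimum \<open>b / c\<close>. Elements are functions and not
  classes, so \<open>c = 0\<close> does not make \<open>\<psi>\<close> the zero function and is
  treated apart.\<close>

lemma L2_Cauchy_Schwarz:
  assumes "\<phi> \<in> L2 T" "\<psi> \<in> L2 T"
  shows "\<bar>L2_inner T \<phi> \<psi>\<bar> \<le> L2_norm T \<phi> * L2_norm T \<psi>"
proof -
  define a b c where "a = L2_inner T \<phi> \<phi>" and "b = L2_inner T \<phi> \<psi>" and "c = L2_inner T \<psi> \<psi>"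
  have q: "0 \<le> a - 2 * s * b + s\<^sup>2 * c" for s
  proof -
    have "0 \<le> (L2_norm T (\<lambda>t. \<phi> t - s * \<psi> t))\<^sup>2" by simp
    also have "\<dots> = a - 2 * L2_inner T \<phi> (\<lambda>t. s * \<psi> t) + L2_inner T (\<lambda>t. s * \<psi> t) (\<lambda>t. s * \<psi> t)"
      using assms by (subst L2_norm_diff_power2) (auto simp: L2_norm_power2 a_def)
    also have "\<dots> = a - 2 * s * b + s\<^sup>2 * c"
      by (simp add: L2_inner_cmult_left L2_inner_commute[of T _ "\<lambda>t. s * \<psi> t"] a_def b_def c_def power2_eq_square
          L2_inner_commute[of T \<psi> \<phi>])
    finally show ?thesis .
  qed
  have "b\<^sup>2 \<le> a * c"
  proof (cases "c = 0")
    case True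
    have "b = 0"
    proof (rule ccontr)
      assume "b \<noteq> 0"
      \<comment> \<open>With \<open>c = 0\<close> the quadratic is affine and takes the value
        \<open>-1\<close> at this point.\<close>
      then show False using q[of "(a + 1) / (2 * b)"] True by simp
    qed
    then show ?thesis using True by simp
  next
    case False
    then have "0 < c" using L2_inner_self_nonneg[of T \<psi>] by (simp add: c_def order_less_le)
    then show ?thesis using q[of "b / c"] by (simp add: field_simps power2_eq_square)
  qed
  then have "\<bar>b\<bar> \<le> sqrt (a * c)" by (metis real_sqrt_abs real_sqrt_le_mono)
  then show ?thesis by (simp add: a_def b_def c_def L2_norm_def real_sqrt_mult)
qed

text \<open>Cauchy-Schwarz against the constant 1, whose norm on \<open>{0..T}\<close> is
  \<open>sqrt T\<close>.\<close>

lemma L2_integral_abs_le: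
  assumes "\<phi> \<in> L2 T" "0 \<le> T"
  shows "(\<integral>t. \<bar>\<phi> t\<bar> \<partial>lebesgue_on {0..T}) \<le> sqrt T * L2_norm T \<phi>"
proof -
  have abs: "(\<lambda>t. \<bar>\<phi> t\<bar>) \<in> L2 T" using assms by (auto simp: L2_def)
  have one: "(\<lambda>t. 1) \<in> L2 T" using L2_indicator[of UNIV] by simp
  have "(\<integral>t. \<bar>\<phi> t\<bar> \<partial>lebesgue_on {0..T}) = L2_inner T (\<lambda>t. \<bar>\<phi> t\<bar>) (\<lambda>t. 1)"
    by (simp add: L2_inner_def)
  also have "\<dots> \<le> L2_norm T (\<lambda>t. \<bar>\<phi> t\<bar>) * L2_norm T (\<lambda>t. 1)"
    using L2_Cauchy_Schwarz[OF abs one] by simp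
  also have "L2_norm T (\<lambda>t. \<bar>\<phi> t\<bar>) = L2_norm T \<phi>" by (simp add: L2_norm_def L2_inner_def)
  also have "L2_norm T (\<lambda>t. 1) = sqrt T" using assms by (simp add: L2_norm_def L2_inner_def)
  finally show ?thesis by (simp add: mult.commute)
qed

section \<open>Orthonormal families and Bessel's inequality\<close>

definition L2_orthonormal :: "real \<Rightarrow> (nat \<Rightarrow> real \<Rightarrow> real) \<Rightarrow> bool" where
  "L2_orthonormal T \<phi> \<longleftrightarrow>
     (\<forall>k. \<phi> k \<in> L2 T) \<and> (\<forall>j k. L2_inner T (\<phi> j) (\<phi> k) = (if j = k then 1 else 0))"

lemma L2_orthonormal_inner_sum:
  assumes "L2_orthonormal T \<phi>"
  shows "L2_inner T (\<lambda>t. \<Sum>k<n. c k * \<phi> k t) (\<phi> j) = (if j < n then c j else 0)"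
proof -
  have L2: "\<phi> k \<in> L2 T" "(\<lambda>t. c k * \<phi> k t) \<in> L2 T" for k using assms by (auto simp: L2_orthonormal_def)
  have "L2_inner T (\<lambda>t. \<Sum>k<n. c k * \<phi> k t) (\<phi> j) = (\<Sum>k<n. L2_inner T (\<lambda>t. c k * \<phi> k t) (\<phi> j))"
    using L2 by (intro L2_inner_sum_left) auto
  also have "\<dots> = (\<Sum>k<n. if k = j then c j else 0)"
    using assms by (intro sum.cong refl) (auto simp: L2_inner_cmult_left L2_orthonormal_def)
  finally show ?thesis by simp
qed

lemma L2_norm_orthonormal_sum:
  assumes "L2_orthonormal T \<phi>"
  shows "(L2_norm T (\<lambda>t. \<Sum>k<n. c k * \<phi> k t))\<^sup>2 = (\<Sum>k<n. (c k)\<^sup>2)"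
proof -
  let ?S = "\<lambda>t. \<Sum>k<n. c k * \<phi> k t"
  have L2: "\<phi> k \<in> L2 T" "(\<lambda>t. c k * \<phi> k t) \<in> L2 T" for k using assms by (auto simp: L2_orthonormal_def)
  then have S: "?S \<in> L2 T" by auto
  have "L2_inner T ?S ?S = (\<Sum>k<n. L2_inner T (\<lambda>t. c k * \<phi> k t) ?S)"
    using L2 S by (intro L2_inner_sum_left) auto
  also have "\<dots> = (\<Sum>k<n. (c k)\<^sup>2)"
    by (intro sum.cong refl)
      (simp add: L2_inner_cmult_left L2_inner_commute[of T _ ?S] L2_orthonormal_inner_sum[OF assms] power2_eq_square)
  finally show ?thesis by (simp add: L2_norm_power2)
qed

lemma L2_Bessel:
  assumes "L2_orthonormal T \<phi>" "\<psi> \<in> L2 T"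
  shows "(\<Sum>k<n. (L2_inner T \<psi> (\<phi> k))\<^sup>2) \<le> (L2_norm T \<psi>)\<^sup>2"
proof -
  let ?c = "\<lambda>k. L2_inner T \<psi> (\<phi> k)" let ?S = "\<lambda>t. \<Sum>k<n. ?c k * \<phi> k t"
  have L2: "\<phi> k \<in> L2 T" "(\<lambda>t. c * \<phi> k t) \<in> L2 T" for k c using assms by (auto simp: L2_orthonormal_def)
  then have S: "?S \<in> L2 T" by auto
  have "L2_inner T ?S \<psi> = (\<Sum>k<n. L2_inner T (\<lambda>t. ?c k * \<phi> k t) \<psi>)"
    using L2 assms by (intro L2_inner_sum_left) auto
  also have "\<dots> = (\<Sum>k<n. (?c k)\<^sup>2)"
    by (simp add: L2_inner_cmult_left L2_inner_commute[of T "\<phi> _" \<psi>] power2_eq_square)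
  finally have "L2_inner T \<psi> ?S = (\<Sum>k<n. (?c k)\<^sup>2)" by (simp add: L2_inner_commute)
  then have "(L2_norm T (\<lambda>t. \<psi> t - ?S t))\<^sup>2 = (L2_norm T \<psi>)\<^sup>2 - (\<Sum>k<n. (?c k)\<^sup>2)"
    using L2_norm_diff_power2[OF assms(2) S] L2_norm_orthonormal_sum[OF assms(1), of ?c n] by simp
  then show ?thesis using zero_le_power2[of "L2_norm T (\<lambda>t. \<psi> t - ?S t)"] by linarith
qed

text \<open>From \<open>n = Suc k\<close> on, the partial sum has \<open>k\<close>-th coefficient
  \<open>c k\<close>, and by Cauchy-Schwarz coefficients differ by at most the norm of the
  remainder. Applied to \<open>h\<close>, this turns \<open>\<alpha> k\<close> into a Fourier
  coefficient, which supplies its integrability and the domination of the partial sums.\<close>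

lemma L2_sums_imp_coeff:
  assumes "L2_orthonormal T \<phi>" "\<psi> \<in> L2 T" "L2_sums T (\<lambda>k t. c k * \<phi> k t) \<psi>"
  shows "c k = L2_inner T \<psi> (\<phi> k)"
proof -
  have L2: "\<phi> k \<in> L2 T" "(\<lambda>t. c * \<phi> k t) \<in> L2 T" for k c using assms by (auto simp: L2_orthonormal_def)
  have norm1: "L2_norm T (\<phi> k) = 1" using assms(1) by (simp add: L2_norm_def L2_orthonormal_def)
  \<comment> \<open>A constant sequence: convergence to zero is the equality claimed.\<close>
  have "(\<lambda>n. L2_inner T \<psi> (\<phi> k) - c k) \<longlonglongrightarrow> 0"
  proof (rule Lim_null_comparison)
    show "(\<lambda>n. L2_norm T (\<lambda>t. \<psi> t - (\<Sum>k<n. c k * \<phi> k t))) \<longlonglongrightarrow> 0"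
      using assms(3) by (simp add: L2_sums_def)
    have "\<bar>L2_inner T \<psi> (\<phi> k) - c k\<bar> \<le> L2_norm T (\<lambda>t. \<psi> t - (\<Sum>k<n. c k * \<phi> k t))" if "k < n" for n
    proof -
      let ?S = "\<lambda>t. \<Sum>k<n. c k * \<phi> k t"
      have S: "?S \<in> L2 T" using L2 by auto
      have "L2_inner T (\<lambda>t. \<psi> t - ?S t) (\<phi> k) = L2_inner T \<psi> (\<phi> k) - c k"
        using L2_inner_diff_left[OF assms(2) S L2(1)[of k]] that
        by (simp add: L2_orthonormal_inner_sum[OF assms(1)])
      then show ?thesis
        using L2_Cauchy_Schwarz[OF L2_diff[OF assms(2) S] L2(1)[of k]] by (simp add: norm1)
    qed
    then show "\<forall>\<^sub>F n in sequentially. norm (L2_inner T \<psi> (\<phi> k) - c k) \<le> L2_norm T (\<lambda>t. \<psi> t - (\<Sum>k<n. c k * \<phi> k t))"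
      by (auto simp: eventually_sequentially intro!: exI[of _ "Suc k"])
  qed
  then show ?thesis by (simp add: LIMSEQ_const_iff)
qed

section \<open>Running integrals and time scaling\<close>

lemma integral_lebesgue_on_subinterval:
  fixes \<phi> :: "real \<Rightarrow> real"
  assumes "t \<le> T"
  shows "(\<integral>s. \<phi> s \<partial>lebesgue_on {0..t}) = (\<integral>s. \<phi> s * indicator {0..t} s \<partial>lebesgue_on {0..T})"
proof -
  have "(\<integral>s. (if s \<in> {0..t} then \<phi> s else 0) \<partial>lebesgue_on {0..T}) = (\<integral>s. \<phi> s \<partial>lebesgue_on {0..t})"
    using assms by (intro integral_restrict) auto
  moreover have "(if s \<in> {0..t} then \<phi> s else 0) = \<phi> s * indicator {0..t} s" for s
    by (simp add: indicator_def)
  ultimately show ?thesis by simp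
qed

text \<open>Serves twice: it makes \<open>gT e T k t\<close> a Fourier coefficient of an indicator,
  and it gives measurability in the sample point of the running integrals of
  \<open>h\<close>.\<close>

lemma L2_integral_eq_inner:
  "t \<le> T \<Longrightarrow> (\<integral>s. \<phi> s \<partial>lebesgue_on {0..t}) = L2_inner T \<phi> (indicator {0..t})"
  by (simp add: L2_inner_def integral_lebesgue_on_subinterval)

lemma integral_lebesgue_on_scale:
  fixes \<phi> :: "real \<Rightarrow> real"
  assumes "0 < T"
  shows "(\<integral>s. \<phi> (s / T) \<partial>lebesgue_on {0..t}) = T * (\<integral>s. \<phi> s \<partial>lebesgue_on {0..t / T})"
    and "integrable (lebesgue_on {0..t}) (\<lambda>s. \<phi> (s / T)) \<longleftrightarrow> integrable (lebesgue_on {0..t / T}) \<phi>"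
proof -
  have eq: "(if s \<in> {0..t} then \<phi> (s / T) else 0) = (\<lambda>r. if r \<in> {0..t / T} then \<phi> r else 0) (0 + (1 / T) * s)" for s
    using assms by (simp add: divide_right_mono field_simps)
  have "(\<integral>s. \<phi> (s / T) \<partial>lebesgue_on {0..t}) = (\<integral>s. (if s \<in> {0..t} then \<phi> (s / T) else 0) \<partial>lebesgue)"
    by (rule Lebesgue_Measure.integral_restrict_UNIV[symmetric]) simp
  also have "\<dots> = T * (\<integral>s. (if s \<in> {0..t / T} then \<phi> s else 0) \<partial>lebesgue)"
    unfolding eq using lebesgue_integral_real_affine[of "1 / T" "\<lambda>r. if r \<in> {0..t / T} then \<phi> r else 0" 0] assms
    by simp
  also have "\<dots> = T * (\<integral>s. \<phi> s \<partial>lebesgue_on {0..t / T})"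
    by (subst Lebesgue_Measure.integral_restrict_UNIV) auto
  finally show "(\<integral>s. \<phi> (s / T) \<partial>lebesgue_on {0..t}) = T * (\<integral>s. \<phi> s \<partial>lebesgue_on {0..t / T})" .
  have "integrable (lebesgue_on {0..t}) (\<lambda>s. \<phi> (s / T)) \<longleftrightarrow> integrable lebesgue (\<lambda>s. if s \<in> {0..t} then \<phi> (s / T) else 0)"
    by (rule Lebesgue_Measure.integrable_restrict_UNIV[symmetric]) simp
  also have "\<dots> \<longleftrightarrow> integrable lebesgue (\<lambda>s. if s \<in> {0..t / T} then \<phi> s else 0)"
    unfolding eq using lebesgue_integrable_real_affine_iff[of "1 / T" "\<lambda>r. if r \<in> {0..t / T} then \<phi> r else 0" 0] assms
    by simp
  also have "\<dots> \<longleftrightarrow> integrable (lebesgue_on {0..t / T}) \<phi>"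
    by (rule Lebesgue_Measure.integrable_restrict_UNIV) simp
  finally show "integrable (lebesgue_on {0..t}) (\<lambda>s. \<phi> (s / T)) \<longleftrightarrow> integrable (lebesgue_on {0..t / T}) \<phi>" .
qed

text \<open>The two factors \<open>1 / sqrt T\<close> cancel the Jacobian \<open>T\<close> of the
  substitution \<open>s / T\<close>.\<close>

lemma gT_dot_orthonormal:
  assumes "L2_orthonormal_basis 1 e" "0 < T"
  shows "L2_orthonormal T (gT_dot e T)"
proof -
  have L2e: "e k \<in> L2 1" for k using assms by (auto simp: L2_orthonormal_basis_def)
  have "gT_dot e T k \<in> L2 T" for k
  proof -
    have "integrable (lebesgue_on {0..T}) (\<lambda>s. e k (s / T))"
      using integral_lebesgue_on_scale(2)[OF assms(2), where \<phi>="e k" and t=T] L2_integrable[OF L2e[of k]] assms(2) by simp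
    then have "(\<lambda>s. e k (s / T)) \<in> borel_measurable (lebesgue_on {0..T})" by auto
    moreover have "integrable (lebesgue_on {0..T}) (\<lambda>s. (e k (s / T))\<^sup>2)"
      using integral_lebesgue_on_scale(2)[OF assms(2), where \<phi>="\<lambda>s. (e k s)\<^sup>2" and t=T] L2e[of k] assms(2) by (simp add: L2_def)
    ultimately show ?thesis
      by (auto simp: L2_def gT_dot_def[abs_def] power_divide)
  qed
  moreover have "L2_inner T (gT_dot e T j) (gT_dot e T k) = L2_inner 1 (e j) (e k)" for j k
    using integral_lebesgue_on_scale(1)[OF assms(2), where \<phi>="\<lambda>s. e j s * e k s" and t=T] assms(2)
    by (simp add: L2_inner_def gT_dot_def)
  ultimately show ?thesis using assms(1) by (simp add: L2_orthonormal_def L2_orthonormal_basis_def)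
qed

lemma gT_eq_integral:
  assumes "0 < T"
  shows "gT e T k t = (\<integral>s. gT_dot e T k s \<partial>lebesgue_on {0..t})"
  using integral_lebesgue_on_scale(1)[OF assms, where \<phi>="e k" and t=t] assms
  by (simp add: gT_def g_def gT_dot_def real_div_sqrt field_simps)

lemma gT_eq_inner:
  assumes "0 < T" "t \<le> T"
  shows "gT e T k t = L2_inner T (indicator {0..t}) (gT_dot e T k)"
  using assms by (simp add: gT_eq_integral L2_integral_eq_inner L2_inner_commute)

text \<open>For fixed \<open>t\<close> these are the squared Fourier coefficients of the indicator
  of \<open>{0..t}\<close>, so Bessel bounds their sums. This is the variance condition for
  convergence of the Brownian series at time \<open>t\<close>.\<close>

lemma summable_gT_power2:
  assumes "L2_orthonormal_basis 1 e" "0 < T" "t \<le> T"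
  shows "summable (\<lambda>k. (gT e T k t)\<^sup>2)"
  using L2_Bessel[OF gT_dot_orthonormal[OF assms(1,2)], of "indicator {0..t}"] assms L2_indicator[of "{0..t}"]
  by (intro summableI_nonneg_bounded) (auto simp: gT_eq_inner)

lemma continuous_on_indefinite_integral:
  fixes \<phi> :: "real \<Rightarrow> real"
  assumes "integrable (lebesgue_on {0..T}) \<phi>"
  shows "continuous_on {0..T} (\<lambda>t. \<integral>s. \<phi> s \<partial>lebesgue_on {0..t})"
proof (rule continuous_on_eq)
  show "continuous_on {0..T} (\<lambda>t. integral {0..t} \<phi>)"
    using assms by (intro indefinite_integral_continuous_1 integrable_on_lebesgue_on) auto
  fix t assume "t \<in> {0..T}"
  then have "integrable (lebesgue_on {0..t}) \<phi>"
    using integrable_subinterval[OF assms, of 0 t] by auto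
  then show "integral {0..t} \<phi> = (\<integral>s. \<phi> s \<partial>lebesgue_on {0..t})"
    by (simp add: lebesgue_integral_eq_integral)
qed

lemma abs_indefinite_integral_le:
  fixes \<phi> :: "real \<Rightarrow> real"
  assumes "integrable (lebesgue_on {0..T}) \<phi>" "t \<le> T"
  shows "\<bar>\<integral>s. \<phi> s \<partial>lebesgue_on {0..t}\<bar> \<le> (\<integral>s. \<bar>\<phi> s\<bar> \<partial>lebesgue_on {0..T})"
proof -
  have "\<bar>\<integral>s. \<phi> s \<partial>lebesgue_on {0..t}\<bar> \<le> (\<integral>s. \<bar>\<phi> s * indicator {0..t} s\<bar> \<partial>lebesgue_on {0..T})"
    using assms(2) integral_norm_bound[of "lebesgue_on {0..T}" "\<lambda>s. \<phi> s * indicator {0..t} s"]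
    by (simp add: integral_lebesgue_on_subinterval)
  also have "\<dots> \<le> (\<integral>s. \<bar>\<phi> s\<bar> \<partial>lebesgue_on {0..T})"
  proof (rule integral_mono')
    show "integrable (lebesgue_on {0..T}) (\<lambda>s. \<bar>\<phi> s\<bar>)" using assms by auto
  qed (auto split: split_indicator)
  finally show ?thesis .
qed

section \<open>The Malliavin derivative as a derivative along paths\<close>

lemma malliavin_integrand_integrable:
  fixes T :: real
  assumes [measurable]: "b \<in> borel_measurable (lebesgue_on {0..T})" and \<phi>: "integrable (lebesgue_on {0..T}) \<phi>"
  shows "integrable (lebesgue_on {0..T}) (\<lambda>t. cis (b t) * complex_of_real (\<integral>s. \<phi> s \<partial>lebesgue_on {0..t}))"
proof (rule lebesgue_on_Icc.integrable_const_bound[where B="\<integral>s. \<bar>\<phi> s\<bar> \<partial>lebesgue_on {0..T}", rotated])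
  have [measurable]: "(\<lambda>t. \<integral>s. \<phi> s \<partial>lebesgue_on {0..t}) \<in> borel_measurable (lebesgue_on {0..T})"
    using continuous_on_indefinite_integral[OF \<phi>] by (rule continuous_imp_measurable_on_sets_lebesgue) simp
  show "(\<lambda>t. cis (b t) * complex_of_real (\<integral>s. \<phi> s \<partial>lebesgue_on {0..t})) \<in> borel_measurable (lebesgue_on {0..T})"
    unfolding cis_conv_exp by measurable
  show "AE t in lebesgue_on {0..T}. norm (cis (b t) * complex_of_real (\<integral>s. \<phi> s \<partial>lebesgue_on {0..t}))
      \<le> (\<integral>s. \<bar>\<phi> s\<bar> \<partial>lebesgue_on {0..T})"
    using abs_indefinite_integral_le[OF \<phi>] by (auto simp: norm_mult)
qed

lemma malliavin_derivative_add_cmult: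
  assumes b: "b \<in> borel_measurable (lebesgue_on {0..T})" and "0 \<le> T"
    and \<phi>: "integrable (lebesgue_on {0..T}) \<phi>" and \<psi>: "integrable (lebesgue_on {0..T}) \<psi>"
  shows "malliavin_derivative u b T (\<lambda>t. \<phi> t + c * \<psi> t) =
    malliavin_derivative u b T \<phi> + c *\<^sub>R malliavin_derivative u b T \<psi>"
proof -
  have split: "(\<integral>s. \<phi> s + c * \<psi> s \<partial>lebesgue_on {0..t}) =
      (\<integral>s. \<phi> s \<partial>lebesgue_on {0..t}) + c * (\<integral>s. \<psi> s \<partial>lebesgue_on {0..t})" if "t \<in> {0..T}" for t
    using integrable_subinterval[OF \<phi>, of 0 t] integrable_subinterval[OF \<psi>, of 0 t] that by auto
  have "(\<integral>t. cis (b t) * complex_of_real (\<integral>s. \<phi> s + c * \<psi> s \<partial>lebesgue_on {0..t}) \<partial>lebesgue_on {0..T}) =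
      (\<integral>t. cis (b t) * complex_of_real (\<integral>s. \<phi> s \<partial>lebesgue_on {0..t})
         + c *\<^sub>R (cis (b t) * complex_of_real (\<integral>s. \<psi> s \<partial>lebesgue_on {0..t})) \<partial>lebesgue_on {0..T})"
    by (rule Bochner_Integration.integral_cong) (auto simp: split algebra_simps scaleR_conv_of_real)
  also have "\<dots> = (\<integral>t. cis (b t) * complex_of_real (\<integral>s. \<phi> s \<partial>lebesgue_on {0..t}) \<partial>lebesgue_on {0..T})
      + c *\<^sub>R (\<integral>t. cis (b t) * complex_of_real (\<integral>s. \<psi> s \<partial>lebesgue_on {0..t}) \<partial>lebesgue_on {0..T})"
    using malliavin_integrand_integrable[OF b \<phi>] malliavin_integrand_integrable[OF b \<psi>] by simp
  finally show ?thesis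
    using split[of T] \<open>0 \<le> T\<close> by (simp add: malliavin_derivative_def algebra_simps)
qed

lemma malliavin_derivative_diff:
  assumes "b \<in> borel_measurable (lebesgue_on {0..T})" "0 \<le> T"
    "integrable (lebesgue_on {0..T}) \<phi>" "integrable (lebesgue_on {0..T}) \<psi>"
  shows "malliavin_derivative u b T (\<lambda>t. \<phi> t - \<psi> t) =
    malliavin_derivative u b T \<phi> - malliavin_derivative u b T \<psi>"
  using malliavin_derivative_add_cmult[OF assms, of u "-1"] by simp

lemma malliavin_derivative_sum:
  assumes "b \<in> borel_measurable (lebesgue_on {0..T})" "0 \<le> T"
    "\<And>k. integrable (lebesgue_on {0..T}) (\<phi> k)"
  shows "malliavin_derivative u b T (\<lambda>t. \<Sum>k<(n::nat). c k * \<phi> k t) =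
    (\<Sum>k<n. c k *\<^sub>R malliavin_derivative u b T (\<phi> k))"
proof (induction n)
  case 0
  show ?case by (simp add: malliavin_derivative_def zero_prod_def)
next
  case (Suc n)
  then show ?case
    using malliavin_derivative_add_cmult[OF assms(1,2), of "\<lambda>t. \<Sum>k<n. c k * \<phi> k t" "\<phi> n" u "c n"] assms(3)
    by simp
qed

text \<open>The 1 comes from the real component and the \<open>T\<close> from the complex one, where
  a running integral bounded by the L1 norm is integrated over time against a factor of modulus
  one.\<close>

lemma norm_malliavin_derivative_le:
  assumes "b \<in> borel_measurable (lebesgue_on {0..T})" "0 \<le> T" "integrable (lebesgue_on {0..T}) \<phi>"
  shows "norm (malliavin_derivative u b T \<phi>) \<le> (1 + T) * (\<integral>s. \<bar>\<phi> s\<bar> \<partial>lebesgue_on {0..T})"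
proof -
  let ?I = "\<integral>s. \<bar>\<phi> s\<bar> \<partial>lebesgue_on {0..T}"
  let ?J = "\<integral>t. cis (b t) * complex_of_real (\<integral>s. \<phi> s \<partial>lebesgue_on {0..t}) \<partial>lebesgue_on {0..T}"
  have "norm ?J \<le> (\<integral>t. norm (cis (b t) * complex_of_real (\<integral>s. \<phi> s \<partial>lebesgue_on {0..t})) \<partial>lebesgue_on {0..T})"
    by (rule integral_norm_bound)
  also have "\<dots> \<le> (\<integral>t. ?I \<partial>lebesgue_on {0..T})"
    using integrable_norm[OF malliavin_integrand_integrable[OF assms(1,3)]] abs_indefinite_integral_le[OF assms(3)]
    by (intro integral_mono) (simp_all add: norm_mult)
  finally have "norm ?J \<le> T * ?I" using assms(2) by simp
  moreover have "norm (malliavin_derivative u b T \<phi>) \<le>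
      norm (\<integral>s. \<phi> s \<partial>lebesgue_on {0..T}) + norm (\<i> * cis u * ?J)"
    unfolding malliavin_derivative_def by (rule norm_Pair_le)
  ultimately show ?thesis
    using abs_indefinite_integral_le[OF assms(3) order_refl]
    unfolding norm_mult real_norm_def distrib_right norm_cis norm_ii mult_1_left by linarith
qed

lemma norm_cis_remainder: "norm (cis (a + d) - cis a - \<i> * d * cis a) \<le> d\<^sup>2"
proof -
  have "cis (a + d) - cis a - \<i> * d * cis a = cis a * (cis d - (1 + \<i> * d))"
    by (simp add: cis_mult algebra_simps)
  then have "norm (cis (a + d) - cis a - \<i> * d * cis a) = norm (cis d - (1 + \<i> * d))"
    by (simp add: norm_mult)
  also have "\<dots> \<le> d\<^sup>2 / 2"
    using iexp_approx1[of d 1] by (simp add: cis_conv_exp power2_eq_square fact_numeral)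
  finally show ?thesis using zero_le_power2[of d] by linarith
qed

text \<open>Takes the place of differentiation under the integral sign: the second-order remainder
  of \<open>cis\<close> is bounded uniformly in time and can be integrated directly.\<close>

lemma has_vector_derivative_quadratic_remainder:
  fixes G :: "real \<Rightarrow> 'b::real_normed_vector"
  assumes "\<And>d. norm (G (s + d) - G s - d *\<^sub>R D) \<le> K * d\<^sup>2"
  shows "(G has_vector_derivative D) (at s)"
  unfolding has_vector_derivative_def has_derivative_at
proof (rule conjI[OF bounded_linear_scaleR_left Lim_null_comparison])
  have "norm (norm (G (s + d) - G s - d *\<^sub>R D) / norm d) \<le> K * \<bar>d\<bar>" if "d \<noteq> 0" for d
  proof -
    have "K * d\<^sup>2 = K * \<bar>d\<bar> * \<bar>d\<bar>" by (simp add: power2_eq_square mult.assoc)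
    then have "norm (G (s + d) - G s - d *\<^sub>R D) / \<bar>d\<bar> \<le> K * \<bar>d\<bar>"
      using assms[of d] that by (subst pos_divide_le_eq) auto
    then show ?thesis by simp
  qed
  then show "\<forall>\<^sub>F d in at 0. norm (norm (G (s + d) - G s - d *\<^sub>R D) / norm d) \<le> K * \<bar>d\<bar>"
    unfolding eventually_at using zero_less_one by blast
  show "((\<lambda>d. K * \<bar>d\<bar>) \<longlongrightarrow> 0) (at 0)" by (auto intro!: tendsto_eq_intros)
qed

text \<open>The direction \<open>c\<close> is bounded by the L1 norm \<open>K\<close> of
  \<open>\<phi>\<close> on \<open>{0..T}\<close>, so the remainder of \<open>cis\<close> is at most
  \<open>K\<^sup>2 * d\<^sup>2\<close> at each time and \<open>T * K\<^sup>2 * d\<^sup>2\<close>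
  after integration. The real component is affine in \<open>s\<close>.\<close>

lemma kinetic_bm_has_vector_derivative:
  assumes [measurable]: "b \<in> borel_measurable (lebesgue_on {0..T})" and "0 \<le> T"
    and \<phi>: "integrable (lebesgue_on {0..T}) \<phi>"
    and c: "\<And>t. c t = (\<integral>s. \<phi> s \<partial>lebesgue_on {0..t})"
  shows "((\<lambda>s. kinetic_bm u z (\<lambda>t. b t + s * c t) T) has_vector_derivative
    malliavin_derivative u (\<lambda>t. b t + s * c t) T \<phi>) (at s)"
proof -
  let ?L = "lebesgue_on {0..T}"
  let ?G = "\<lambda>s. \<integral>t. cis (b t + s * c t) \<partial>?L"
  let ?D = "\<i> * (\<integral>t. cis (b t + s * c t) * complex_of_real (c t) \<partial>?L)"
  define K where "K = (\<integral>s. \<bar>\<phi> s\<bar> \<partial>?L)"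
  have [measurable]: "c \<in> borel_measurable ?L"
    using continuous_imp_measurable_on_sets_lebesgue[OF continuous_on_indefinite_integral[OF \<phi>]] by (simp flip: c)
  have cK: "\<bar>c t\<bar> \<le> K" if "t \<in> {0..T}" for t
    using abs_indefinite_integral_le[OF \<phi>, of t] that by (simp add: c K_def)
  have m: "(\<lambda>t. cis (b t + r * c t)) \<in> borel_measurable ?L" for r
    unfolding cis_conv_exp by measurable
  then have i1: "integrable ?L (\<lambda>t. cis (b t + r * c t))" for r
    by (intro lebesgue_on_Icc.integrable_const_bound[where B=1]) auto
  have i2: "integrable ?L (\<lambda>t. cis (b t + s * c t) * complex_of_real (c t))"
    using malliavin_integrand_integrable[of "\<lambda>t. b t + s * c t" T \<phi>] \<phi> by (simp add: c[symmetric])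
  have "norm (?G (s + d) - ?G s - d *\<^sub>R ?D) \<le> (T * K\<^sup>2) * d\<^sup>2" for d
  proof -
    let ?r = "\<lambda>t. cis (b t + (s + d) * c t) - cis (b t + s * c t) - (\<i> * d) * (cis (b t + s * c t) * complex_of_real (c t))"
    have ir: "integrable ?L ?r" using i1 i2 by simp
    have "d *\<^sub>R ?D = (\<integral>t. (\<i> * d) * (cis (b t + s * c t) * complex_of_real (c t)) \<partial>?L)"
      by (simp add: scaleR_conv_of_real)
    then have eq: "?G (s + d) - ?G s - d *\<^sub>R ?D = (\<integral>t. ?r t \<partial>?L)"
      using i1 i2 by (simp only: Bochner_Integration.integral_diff Bochner_Integration.integrable_diff
          Bochner_Integration.integrable_mult_right)
    have "norm (?G (s + d) - ?G s - d *\<^sub>R ?D) \<le> (\<integral>t. norm (?r t) \<partial>?L)"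
      unfolding eq by (rule integral_norm_bound)
    also have "\<dots> \<le> (\<integral>t. K\<^sup>2 * d\<^sup>2 \<partial>?L)"
    proof (rule integral_mono)
      fix t assume "t \<in> space ?L"
      then have "(c t)\<^sup>2 \<le> K\<^sup>2" using cK[of t] by (simp flip: abs_le_square_iff)
      then have "(d * c t)\<^sup>2 \<le> K\<^sup>2 * d\<^sup>2" using mult_left_mono[of "(c t)\<^sup>2" "K\<^sup>2" "d\<^sup>2"] by (simp add: power_mult_distrib mult.commute)
      moreover have "norm (?r t) \<le> (d * c t)\<^sup>2"
        using norm_cis_remainder[of "b t + s * c t" "d * c t"] by (simp add: algebra_simps)
      ultimately show "norm (?r t) \<le> K\<^sup>2 * d\<^sup>2" by linarith
    qed (use ir in auto)
    finally show ?thesis using \<open>0 \<le> T\<close> by simp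
  qed
  then have "(?G has_vector_derivative ?D) (at s)"
    by (rule has_vector_derivative_quadratic_remainder)
  then have "((\<lambda>s. z + cis u * ?G s) has_vector_derivative 0 + cis u * ?D) (at s)"
    by (intro has_vector_derivative_add has_vector_derivative_mult_right has_vector_derivative_const)
  moreover have "((\<lambda>s. u + (b T + s * c T)) has_vector_derivative c T) (at s)"
    by (auto intro!: derivative_eq_intros simp flip: has_real_derivative_iff_has_vector_derivative)
  ultimately have "((\<lambda>s. (u + (b T + s * c T), z + cis u * ?G s)) has_vector_derivative (c T, 0 + cis u * ?D)) (at s)"
    by (rule has_vector_derivative_Pair[rotated])
  then show ?thesis by (simp add: kinetic_bm_def malliavin_derivative_def c[symmetric] mult_ac)
qed

section \<open>Test functions: bounds, chain rule and joint measurability\<close>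

lemma C1_bounded_obtain:
  assumes "C1_bounded f f'"
  obtains C where "0 \<le> C" "\<And>y. \<bar>f y\<bar> \<le> C" "\<And>y w. \<bar>blinfun_apply (f' y) w\<bar> \<le> C * norm w"
proof -
  from assms obtain C1 C2 where C: "\<And>y. \<bar>f y\<bar> \<le> C1" "\<And>y. norm (f' y) \<le> C2"
    unfolding C1_bounded_def bounded_iff by auto
  let ?C = "max 0 (max C1 C2)"
  have "\<bar>blinfun_apply (f' y) w\<bar> \<le> ?C * norm w" for y w
  proof -
    have "\<bar>blinfun_apply (f' y) w\<bar> \<le> norm (f' y) * norm w" using norm_blinfun[of "f' y" w] by simp
    also have "\<dots> \<le> ?C * norm w" using C(2)[of y] by (intro mult_right_mono) auto
    finally show ?thesis .
  qed
  moreover have "\<bar>f y\<bar> \<le> ?C" for y using C(1)[of y] by simp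
  ultimately show ?thesis by (intro that[of ?C]) auto
qed

lemma C1_bounded_measurable:
  assumes "C1_bounded f f'"
  shows "f \<in> borel_measurable borel"
    and "X \<in> borel_measurable N \<Longrightarrow> Y \<in> borel_measurable N \<Longrightarrow>
      (\<lambda>\<omega>. blinfun_apply (f' (X \<omega>)) (Y \<omega>)) \<in> borel_measurable N"
proof -
  have "continuous_on UNIV f"
    using assms by (auto simp: C1_bounded_def intro!: continuous_at_imp_continuous_on has_derivative_continuous)
  then show "f \<in> borel_measurable borel" by (rule borel_measurable_continuous_onI)
  assume [measurable]: "X \<in> borel_measurable N" "Y \<in> borel_measurable N"
  have "continuous_on UNIV (\<lambda>p. blinfun_apply (f' (fst p)) (snd p))"
    using assms by (auto simp: C1_bounded_def intro!: continuous_intros continuous_on_compose2[of UNIV f'])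
  then show "(\<lambda>\<omega>. blinfun_apply (f' (X \<omega>)) (Y \<omega>)) \<in> borel_measurable N"
    by (rule borel_measurable_continuous_Pair[rotated 2]) measurable
qed

lemma f_kinetic_bm_has_derivative:
  assumes "C1_bounded f f'" and "b \<in> borel_measurable (lebesgue_on {0..T})" "0 \<le> T"
    "integrable (lebesgue_on {0..T}) \<phi>" "\<And>t. c t = (\<integral>s. \<phi> s \<partial>lebesgue_on {0..t})"
  shows "((\<lambda>s. f (kinetic_bm u z (\<lambda>t. b t + s * c t) T)) has_field_derivative
    blinfun_apply (f' (kinetic_bm u z (\<lambda>t. b t + s * c t) T)) (malliavin_derivative u (\<lambda>t. b t + s * c t) T \<phi>)) (at s)"
proof -
  have f: "(f has_derivative blinfun_apply (f' y)) (at y)" for y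
    using assms(1) unfolding C1_bounded_def by blast
  have "((\<lambda>s. kinetic_bm u z (\<lambda>t. b t + s * c t) T) has_derivative
      (\<lambda>d. d *\<^sub>R malliavin_derivative u (\<lambda>t. b t + s * c t) T \<phi>)) (at s)"
    using kinetic_bm_has_vector_derivative[OF assms(2-5)] by (simp only: has_vector_derivative_def)
  from has_derivative_compose[OF this f] show ?thesis
    by (rule has_derivative_imp_has_field_derivative) (simp add: blinfun.scaleR_right mult.commute)
qed

text \<open>With time rounded to a grid, only countably many of the measurable sections occur;
  continuity in time then gives a pointwise limit.\<close>

lemma measurable_Caratheodory:
  fixes H :: "'a \<Rightarrow> real \<Rightarrow> real"
  assumes meas: "\<And>t. t \<in> {0..T} \<Longrightarrow> (\<lambda>\<omega>. H \<omega> t) \<in> borel_measurable N"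
    and cont: "\<And>\<omega>. \<omega> \<in> space N \<Longrightarrow> continuous_on {0..T} (H \<omega>)"
  shows "(\<lambda>(\<omega>, t). H \<omega> t) \<in> borel_measurable (N \<Otimes>\<^sub>M lebesgue_on {0..T})"
proof -
  \<comment> \<open>Rounding down keeps the grid point of a time in \<open>{0..T}\<close> inside
    \<open>{0..T}\<close>.\<close>
  define r where "r n t = real_of_int \<lfloor>real (Suc n) * t\<rfloor> / real (Suc n)" for n t
  have r: "r n t \<in> {0..T}" if "t \<in> {0..T}" for n t
  proof -
    have "real_of_int \<lfloor>real (Suc n) * t\<rfloor> \<le> real (Suc n) * t" by simp
    then have "r n t \<le> t" unfolding r_def by (subst pos_divide_le_eq) (simp_all add: mult.commute)
    then show ?thesis using that by (auto simp: r_def)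
  qed
  have lim: "(\<lambda>n. r n t) \<longlonglongrightarrow> t" for t
  proof -
    have "(\<lambda>n. r n t - t) \<longlonglongrightarrow> 0"
    proof (rule Lim_null_comparison[OF _ LIMSEQ_inverse_real_of_nat])
      have "norm (r n t - t) \<le> inverse (real (Suc n))" for n
      proof -
        have "r n t - t = (real_of_int \<lfloor>real (Suc n) * t\<rfloor> - real (Suc n) * t) / real (Suc n)"
          by (simp add: r_def diff_divide_distrib del: of_nat_Suc)
        moreover have "\<bar>real_of_int \<lfloor>real (Suc n) * t\<rfloor> - real (Suc n) * t\<bar> \<le> 1" by linarith
        ultimately show ?thesis by (simp add: abs_divide inverse_eq_divide divide_right_mono del: of_nat_Suc)
      qed
      then show "\<forall>\<^sub>F n in sequentially. norm (r n t - t) \<le> inverse (real (Suc n))" by simp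
    qed
    then show ?thesis by (simp add: LIM_zero_iff)
  qed
  have [measurable]: "(\<lambda>t. t) \<in> borel_measurable (lebesgue_on {0..T})"
    by (intro measurable_restrict_space1 measurable_completion) simp
  show ?thesis
  proof (rule borel_measurable_LIMSEQ_metric)
    fix n
    \<comment> \<open>Outside \<open>{0..T}\<close> nothing is known about the sections of
      \<open>H\<close>; the default 0 keeps \<open>F i\<close> measurable for every integer
      \<open>i\<close>.\<close>
    define F where "F i p = (if real_of_int i / real (Suc n) \<in> {0..T} then H (fst p) (real_of_int i / real (Suc n)) else 0)"
      for i :: int and p :: "'a \<times> real"
    have F: "F i \<in> borel_measurable (N \<Otimes>\<^sub>M lebesgue_on {0..T})" for i
    proof (cases "real_of_int i / real (Suc n) \<in> {0..T}")
      case True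
      then have "F i = (\<lambda>p. H (fst p) (real_of_int i / real (Suc n)))" unfolding F_def by (intro ext) (rule if_P)
      then show ?thesis using measurable_compose[OF measurable_fst meas[OF True]] by simp
    next
      case False
      then have "F i = (\<lambda>p. 0)" unfolding F_def by (intro ext) (rule if_not_P)
      then show ?thesis by simp
    qed
    have "(\<lambda>p. \<lfloor>real (Suc n) * snd p\<rfloor>) \<in> N \<Otimes>\<^sub>M lebesgue_on {0..T} \<rightarrow>\<^sub>M count_space UNIV"
      by (rule measurable_compose[OF measurable_snd], measurable)
    with F have "(\<lambda>p. F \<lfloor>real (Suc n) * snd p\<rfloor> p) \<in> borel_measurable (N \<Otimes>\<^sub>M lebesgue_on {0..T})"
      by (rule measurable_compose_countable)
    moreover have "F \<lfloor>real (Suc n) * snd p\<rfloor> p = H (fst p) (r n (snd p))"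
      if "p \<in> space (N \<Otimes>\<^sub>M lebesgue_on {0..T})" for p
      using r[of "snd p" n] that by (auto simp: F_def r_def space_pair_measure)
    ultimately show "(\<lambda>p. H (fst p) (r n (snd p))) \<in> borel_measurable (N \<Otimes>\<^sub>M lebesgue_on {0..T})"
      by (simp cong: measurable_cong)
  next
    fix p assume "p \<in> space (N \<Otimes>\<^sub>M lebesgue_on {0..T})"
    then have "fst p \<in> space N" "snd p \<in> {0..T}" by (auto simp: space_pair_measure)
    then show "(\<lambda>n. H (fst p) (r n (snd p))) \<longlonglongrightarrow> (case p of (\<omega>, t) \<Rightarrow> H \<omega> t)"
      using continuous_on_tendsto_compose[OF cont lim[of "snd p"]] r by (auto simp: case_prod_beta)
  qed
qed

text \<open>A random element of L2 need not be jointly measurable in sample point and time. Its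
  running integrals are, being continuous in time, and the Malliavin derivative sees the direction
  only through them.\<close>

lemma measurable_malliavin_derivative:
  assumes b[measurable]: "(\<lambda>(\<omega>, t). b \<omega> t) \<in> borel_measurable (N \<Otimes>\<^sub>M lebesgue_on {0..T})"
    and meas: "\<And>t. t \<in> {0..T} \<Longrightarrow> (\<lambda>\<omega>. \<integral>s. h \<omega> s \<partial>lebesgue_on {0..t}) \<in> borel_measurable N"
    and int: "\<And>\<omega>. \<omega> \<in> space N \<Longrightarrow> integrable (lebesgue_on {0..T}) (h \<omega>)" and "0 \<le> T"
  shows "(\<lambda>\<omega>. malliavin_derivative u (b \<omega>) T (h \<omega>)) \<in> borel_measurable N"
proof -
  have [measurable]: "(\<lambda>(\<omega>, t). \<integral>s. h \<omega> s \<partial>lebesgue_on {0..t}) \<in> borel_measurable (N \<Otimes>\<^sub>M lebesgue_on {0..T})"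
    by (rule measurable_Caratheodory[OF meas continuous_on_indefinite_integral[OF int]])
  have "(\<lambda>(\<omega>, t). cis (b \<omega> t) * complex_of_real (\<integral>s. h \<omega> s \<partial>lebesgue_on {0..t}))
      \<in> borel_measurable (N \<Otimes>\<^sub>M lebesgue_on {0..T})"
    unfolding cis_conv_exp by measurable
  then have [measurable]: "(\<lambda>\<omega>. \<integral>t. cis (b \<omega> t) * complex_of_real (\<integral>s. h \<omega> s \<partial>lebesgue_on {0..t}) \<partial>lebesgue_on {0..T})
      \<in> borel_measurable N"
    by (rule lebesgue_on_Icc.borel_measurable_lebesgue_integral)
  have [measurable]: "(\<lambda>\<omega>. \<integral>s. h \<omega> s \<partial>lebesgue_on {0..T}) \<in> borel_measurable N"
    using meas \<open>0 \<le> T\<close> by simp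
  show ?thesis unfolding malliavin_derivative_def by measurable
qed

lemma measurable_kinetic_bm:
  assumes [measurable]: "(\<lambda>(\<omega>, t). b \<omega> t) \<in> borel_measurable (N \<Otimes>\<^sub>M lebesgue_on {0..T})"
    "(\<lambda>\<omega>. b \<omega> T) \<in> borel_measurable N"
  shows "(\<lambda>\<omega>. kinetic_bm u z (b \<omega>) T) \<in> borel_measurable N"
proof -
  have "(\<lambda>(\<omega>, t). cis (b \<omega> t)) \<in> borel_measurable (N \<Otimes>\<^sub>M lebesgue_on {0..T})"
    unfolding cis_conv_exp by measurable
  then have [measurable]: "(\<lambda>\<omega>. \<integral>t. cis (b \<omega> t) \<partial>lebesgue_on {0..T}) \<in> borel_measurable N"
    by (rule lebesgue_on_Icc.borel_measurable_lebesgue_integral)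
  show ?thesis unfolding kinetic_bm_def by measurable
qed

section \<open>Integration by parts in one coordinate\<close>

text \<open>Changing the path on a null set of times is harmless except at \<open>T\<close>, whose
  value is the real component.\<close>

lemma kinetic_bm_cong_AE:
  assumes "b \<in> borel_measurable (lebesgue_on {0..T})" "b' \<in> borel_measurable (lebesgue_on {0..T})"
    and "b T = b' T" "AE t in lebesgue_on {0..T}. b t = b' t"
  shows "kinetic_bm u z b T = kinetic_bm u z b' T"
proof -
  have "(\<integral>t. cis (b t) \<partial>lebesgue_on {0..T}) = (\<integral>t. cis (b' t) \<partial>lebesgue_on {0..T})"
    using assms(1,2) unfolding cis_conv_exp
    by (intro integral_cong_AE) (use assms(4) in \<open>auto elim!: eventually_mono\<close>)
  then show ?thesis using assms(3) by (simp add: kinetic_bm_def)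
qed

lemma malliavin_derivative_cong_AE:
  assumes b: "b \<in> borel_measurable (lebesgue_on {0..T})" "b' \<in> borel_measurable (lebesgue_on {0..T})"
    and \<phi>: "integrable (lebesgue_on {0..T}) \<phi>" and eq: "AE t in lebesgue_on {0..T}. b t = b' t"
  shows "malliavin_derivative u b T \<phi> = malliavin_derivative u b' T \<phi>"
proof -
  have "(\<integral>t. cis (b t) * complex_of_real (\<integral>s. \<phi> s \<partial>lebesgue_on {0..t}) \<partial>lebesgue_on {0..T}) =
      (\<integral>t. cis (b' t) * complex_of_real (\<integral>s. \<phi> s \<partial>lebesgue_on {0..t}) \<partial>lebesgue_on {0..T})"
    using malliavin_integrand_integrable[OF b(1) \<phi>] malliavin_integrand_integrable[OF b(2) \<phi>]
    by (intro integral_cong_AE) (use eq in \<open>auto elim!: eventually_mono\<close>)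
  then show ?thesis by (simp add: malliavin_derivative_def)
qed

section \<open>The Brownian series as a function of its coordinates\<close>

definition brownian :: "(nat \<Rightarrow> real \<Rightarrow> real) \<Rightarrow> real \<Rightarrow> (nat \<Rightarrow> real) \<Rightarrow> real \<Rightarrow> real" where
  "brownian e T x t = (\<Sum>k. gT e T k t * x k)"

context
  fixes e :: "nat \<Rightarrow> real \<Rightarrow> real" and T :: real
  assumes basis: "L2_orthonormal_basis 1 e" and T_pos: "0 < T"
begin

lemma gT_dot_L2: "gT_dot e T k \<in> L2 T"
  using gT_dot_orthonormal[OF basis T_pos] by (simp add: L2_orthonormal_def)

lemma gT_dot_integrable: "integrable (lebesgue_on {0..T}) (gT_dot e T k)"
  using gT_dot_L2 by (rule L2_integrable)

lemma gT_measurable [measurable]: "gT e T k \<in> borel_measurable (lebesgue_on {0..T})"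
  using continuous_imp_measurable_on_sets_lebesgue[OF continuous_on_indefinite_integral[OF gT_dot_integrable[of k]]]
  by (simp flip: gT_eq_integral[OF T_pos])

lemma brownian_measurable_pair:
  assumes \<xi>: "\<And>k. \<xi> k \<in> borel_measurable N"
  shows "(\<lambda>(\<omega>, t). brownian e T (\<lambda>l. \<xi> l \<omega>) t) \<in> borel_measurable (N \<Otimes>\<^sub>M lebesgue_on {0..T})"
proof -
  have [measurable]: "(\<lambda>p. \<xi> k (fst p)) \<in> borel_measurable (N \<Otimes>\<^sub>M lebesgue_on {0..T})"
    "(\<lambda>p. gT e T k (snd p)) \<in> borel_measurable (N \<Otimes>\<^sub>M lebesgue_on {0..T})" for k
    using measurable_compose[OF measurable_fst \<xi>] measurable_compose[OF measurable_snd gT_measurable] by auto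
  show ?thesis unfolding brownian_def case_prod_beta by measurable
qed

lemma brownian_path_measurable [measurable]: "brownian e T x \<in> borel_measurable (lebesgue_on {0..T})"
  unfolding brownian_def[abs_def] by measurable

lemma brownian_measurable:
  assumes [measurable]: "\<And>k. \<xi> k \<in> borel_measurable N"
  shows "(\<lambda>\<omega>. brownian e T (\<lambda>l. \<xi> l \<omega>) t) \<in> borel_measurable N"
  unfolding brownian_def by measurable

text \<open>The time \<open>T\<close> is listed separately: it is a null set of times, yet the
  kinetic process evaluates the path there.\<close>

definition brownian_converges :: "(nat \<Rightarrow> real) \<Rightarrow> bool" where
  "brownian_converges x \<longleftrightarrow> summable (\<lambda>k. gT e T k T * x k) \<and>
     (AE t in lebesgue_on {0..T}. summable (\<lambda>k. gT e T k t * x k))"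

text \<open>Convergence is almost sure at each fixed time; Fubini exchanges the order of the two
  "almost every" quantifiers.\<close>

lemma AE_brownian_converges: "AE x in gaussian_seq. brownian_converges x"
proof -
  let ?L = "lebesgue_on {0..T}"
  interpret p: pair_sigma_finite ?L gaussian_seq ..
  have AE: "AE x in gaussian_seq. summable (\<lambda>k. gT e T k t * x k)" if "t \<le> T" for t
    using summable_gT_power2[OF basis T_pos that] by (rule AE_summable_gaussian_series)
  have [measurable]: "(\<lambda>p. gT e T k (fst p)) \<in> borel_measurable (?L \<Otimes>\<^sub>M gaussian_seq)"
    "(\<lambda>p. snd p k) \<in> borel_measurable (?L \<Otimes>\<^sub>M gaussian_seq)" for k
    using measurable_compose[OF measurable_fst gT_measurable]
      measurable_compose[OF measurable_snd measurable_gaussian_seq_component(2)] by auto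
  \<comment> \<open>The exchange needs a jointly measurable set; the Cauchy property is a countable
    condition on measurable partial sums.\<close>
  have "{p \<in> space (?L \<Otimes>\<^sub>M gaussian_seq). Cauchy (\<lambda>n. \<Sum>k<n. gT e T k (fst p) * snd p k)} \<in> sets (?L \<Otimes>\<^sub>M gaussian_seq)"
    by (rule sets_Collect_Cauchy) measurable
  then have "{p \<in> space (?L \<Otimes>\<^sub>M gaussian_seq). summable (\<lambda>k. gT e T k (fst p) * snd p k)} \<in> sets (?L \<Otimes>\<^sub>M gaussian_seq)"
    by (simp add: summable_iff_convergent Cauchy_convergent_iff)
  from p.AE_commute[OF this]
  have "AE x in gaussian_seq. AE t in ?L. summable (\<lambda>k. gT e T k t * x k)"
    using AE by auto
  with AE[OF order_refl] show ?thesis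
    unfolding brownian_converges_def by eventually_elim simp
qed

lemma brownian_upd:
  assumes "summable (\<lambda>k. gT e T k t * x k)"
  shows "brownian e T (x(k := s)) t = (brownian e T x t - x k * gT e T k t) + s * gT e T k t"
proof -
  have "(\<lambda>j. gT e T j t * x j + (if j = k then gT e T j t * (s - x j) else 0)) sums
      (brownian e T x t + gT e T k t * (s - x k))"
    unfolding brownian_def by (intro sums_add summable_sums[OF assms] sums_single)
  moreover have "gT e T j t * x j + (if j = k then gT e T j t * (s - x j) else 0) = gT e T j t * (x(k := s)) j" for j
    by (simp add: algebra_simps)
  ultimately have "(\<lambda>j. gT e T j t * (x(k := s)) j) sums (brownian e T x t + gT e T k t * (s - x k))"
    by (simp only:)
  from sums_unique[OF this, symmetric] show ?thesis by (simp add: brownian_def algebra_simps)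
qed

text \<open>For fixed \<open>x\<close>, moving coordinate \<open>k\<close> moves the path along a
  straight line, so this is one-dimensional integration by parts for \<open>f\<close> evaluated
  along that line.\<close>

lemma resampled_integration_by_parts:
  assumes f: "C1_bounded f f'" and conv: "brownian_converges x"
    and a: "\<And>s. (a has_field_derivative a' s) (at s)"
    and int: "integrable std_normal a" "integrable std_normal (\<lambda>s. a s * s - a' s)"
  shows "(\<integral>s. (a s * s - a' s) * f (kinetic_bm u z (brownian e T (x(k := s))) T)
      - a s * blinfun_apply (f' (kinetic_bm u z (brownian e T (x(k := s))) T))
          (malliavin_derivative u (brownian e T (x(k := s))) T (gT_dot e T k)) \<partial>std_normal) = 0"
proof -
  \<comment> \<open>The path with its \<open>k\<close>-th term removed. The resampled path is
    \<open>b\<close> plus \<open>s\<close> times \<open>gT e T k\<close> only where the series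
    converges, hence the replacements for almost every time in \<open>kin\<close> and
    \<open>mal\<close>.\<close>
  define b where "b t = brownian e T x t - x k * gT e T k t" for t
  have [measurable]: "b \<in> borel_measurable (lebesgue_on {0..T})" unfolding b_def[abs_def] by measurable
  have m: "(\<lambda>t. b t + s * gT e T k t) \<in> borel_measurable (lebesgue_on {0..T})" for s by measurable
  have AE: "AE t in lebesgue_on {0..T}. brownian e T (x(k := s)) t = b t + s * gT e T k t" for s
    using conv unfolding brownian_converges_def b_def by (auto elim!: eventually_mono simp: brownian_upd)
  have kin: "kinetic_bm u z (brownian e T (x(k := s))) T = kinetic_bm u z (\<lambda>t. b t + s * gT e T k t) T" for s
    using conv by (intro kinetic_bm_cong_AE AE m brownian_path_measurable)
      (simp add: brownian_converges_def b_def brownian_upd)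
  have mal: "malliavin_derivative u (brownian e T (x(k := s))) T (gT_dot e T k) =
      malliavin_derivative u (\<lambda>t. b t + s * gT e T k t) T (gT_dot e T k)" for s
    by (intro malliavin_derivative_cong_AE AE m brownian_path_measurable gT_dot_integrable)
  define \<Phi> where "\<Phi> s = f (kinetic_bm u z (\<lambda>t. b t + s * gT e T k t) T)" for s
  define \<Phi>' where "\<Phi>' s = blinfun_apply (f' (kinetic_bm u z (\<lambda>t. b t + s * gT e T k t) T))
      (malliavin_derivative u (\<lambda>t. b t + s * gT e T k t) T (gT_dot e T k))" for s
  obtain C where C: "0 \<le> C" "\<And>y. \<bar>f y\<bar> \<le> C" "\<And>y w. \<bar>blinfun_apply (f' y) w\<bar> \<le> C * norm w"
    using C1_bounded_obtain[OF f] by metis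
  define K where "K = (1 + T) * (\<integral>s. \<bar>gT_dot e T k s\<bar> \<partial>lebesgue_on {0..T})"
  have "\<bar>\<Phi>' s\<bar> \<le> C * K" for s
  proof -
    have "\<bar>\<Phi>' s\<bar> \<le> C * norm (malliavin_derivative u (\<lambda>t. b t + s * gT e T k t) T (gT_dot e T k))"
      unfolding \<Phi>'_def by (rule C(3))
    also have "\<dots> \<le> C * K"
      unfolding K_def using T_pos C(1) m gT_dot_integrable
      by (intro mult_left_mono norm_malliavin_derivative_le) auto
    finally show ?thesis .
  qed
  then have b1: "\<bar>\<Phi>' s\<bar> \<le> max C (C * K)" for s by (meson max.coboundedI2)
  have b2: "\<bar>\<Phi> s\<bar> \<le> max C (C * K)" for s
    unfolding \<Phi>_def using C(2) by (meson max.coboundedI1)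
  have deriv: "(\<Phi> has_field_derivative \<Phi>' s) (at s)" for s
    unfolding \<Phi>_def[abs_def] \<Phi>'_def using T_pos
    by (intro f_kinetic_bm_has_derivative[OF f] gT_dot_integrable gT_eq_integral) auto
  have "(\<lambda>(s, t). b t + s * gT e T k t) \<in> borel_measurable (borel \<Otimes>\<^sub>M lebesgue_on {0..T})"
  proof -
    have [measurable]: "(\<lambda>p. b (snd p)) \<in> borel_measurable (borel \<Otimes>\<^sub>M lebesgue_on {0..T})"
      "(\<lambda>p. gT e T k (snd p)) \<in> borel_measurable (borel \<Otimes>\<^sub>M lebesgue_on {0..T})"
      by (auto intro: measurable_compose[OF measurable_snd])
    show ?thesis unfolding case_prod_beta by measurable
  qed
  then have "\<Phi>' \<in> borel_measurable borel"
    unfolding \<Phi>'_def[abs_def] using T_pos gT_dot_integrable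
    by (intro C1_bounded_measurable(2)[OF f] measurable_kinetic_bm measurable_malliavin_derivative) auto
  from std_normal_integration_by_parts[OF a deriv b2 b1 this int]
  show ?thesis unfolding kin mal \<Phi>_def \<Phi>'_def .
qed

end

lemma has_field_derivative_imp_difference_quotient_LIMSEQ:
  fixes a :: "real \<Rightarrow> real"
  assumes "(a has_field_derivative D) (at r)"
  shows "(\<lambda>n. (a (r + inverse (real (Suc n))) - a r) / inverse (real (Suc n))) \<longlonglongrightarrow> D"
proof -
  have "filterlim (\<lambda>n. inverse (real (Suc n))) (at 0) sequentially"
    by (rule filterlim_atI[OF LIMSEQ_inverse_real_of_nat]) simp
  with assms show ?thesis unfolding DERIV_def by (rule filterlim_compose)
qed

text \<open>The set of points where \<open>A\<close> is differentiable in its \<open>k\<close>-th coordinate need not be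
  measurable, so the partial derivative is replaced by a measurable limit of difference quotients,
  and "the resampled integral vanishes" is a measurable event that can be transferred from
  \<open>M\<close> to the canonical space.\<close>

lemma integration_by_parts_component:
  fixes A :: "(nat \<Rightarrow> real) \<Rightarrow> real" and u :: real and z :: complex
  assumes basis: "L2_orthonormal_basis 1 e" and T_pos: "0 < T" and f: "C1_bounded f f'"
    and \<xi>: "(\<lambda>\<omega> l. \<xi> l \<omega>) \<in> M \<rightarrow>\<^sub>M gaussian_seq" "distr M gaussian_seq (\<lambda>\<omega> l. \<xi> l \<omega>) = gaussian_seq"
    and A: "A \<in> borel_measurable (Pi\<^sub>M UNIV (\<lambda>_. borel))"
    and diff: "AE \<omega> in M. \<forall>r. (\<lambda>s. A ((\<lambda>l. \<xi> l \<omega>)(k := s))) field_differentiable (at r)"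
    and int: "integrable M (\<lambda>\<omega>. A (\<lambda>l. \<xi> l \<omega>))"
      "integrable M (\<lambda>\<omega>. A (\<lambda>l. \<xi> l \<omega>) * \<xi> k \<omega> - partial_deriv k A (\<lambda>l. \<xi> l \<omega>))"
  defines "X \<equiv> \<lambda>\<omega>. kinetic_bm u z (brownian e T (\<lambda>l. \<xi> l \<omega>)) T"
    and "DX \<equiv> \<lambda>\<omega>. malliavin_derivative u (brownian e T (\<lambda>l. \<xi> l \<omega>)) T (gT_dot e T k)"
  shows "integrable M (\<lambda>\<omega>. A (\<lambda>l. \<xi> l \<omega>) * blinfun_apply (f' (X \<omega>)) (DX \<omega>))"
    and "(\<integral>\<omega>. (A (\<lambda>l. \<xi> l \<omega>) * \<xi> k \<omega> - partial_deriv k A (\<lambda>l. \<xi> l \<omega>)) * f (X \<omega>) \<partial>M) =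
      (\<integral>\<omega>. A (\<lambda>l. \<xi> l \<omega>) * blinfun_apply (f' (X \<omega>)) (DX \<omega>) \<partial>M)"
proof -
  define F where "F x = f (kinetic_bm u z (brownian e T x) T)" for x
  define F' where "F' x = blinfun_apply (f' (kinetic_bm u z (brownian e T x) T))
    (malliavin_derivative u (brownian e T x) T (gT_dot e T k))" for x
  define dA where "dA x = lim (\<lambda>n. (A (x(k := x k + inverse (real (Suc n)))) - A x) / inverse (real (Suc n)))" for x
  have [measurable]: "A \<in> borel_measurable gaussian_seq" using A by (simp cong: measurable_cong_sets add: sets_gaussian_seq)
  have joint: "(\<lambda>(x, t). brownian e T x t) \<in> borel_measurable (gaussian_seq \<Otimes>\<^sub>M lebesgue_on {0..T})"
    using brownian_measurable_pair[OF basis T_pos, of "\<lambda>l x. x l" gaussian_seq] by simp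
  have end_point: "(\<lambda>x. brownian e T x T) \<in> borel_measurable gaussian_seq"
    using brownian_measurable[OF basis T_pos, of "\<lambda>l x. x l" gaussian_seq T] by simp
  note kin = measurable_kinetic_bm[OF joint end_point, of u z]
  have [measurable]: "F \<in> borel_measurable gaussian_seq"
    unfolding F_def[abs_def] by (rule measurable_compose[OF kin C1_bounded_measurable(1)[OF f]])
  have [measurable]: "F' \<in> borel_measurable gaussian_seq"
    unfolding F'_def[abs_def] using T_pos gT_dot_integrable[OF basis T_pos]
    by (intro C1_bounded_measurable(2)[OF f] kin measurable_malliavin_derivative[OF joint]) auto
  have [measurable]: "dA \<in> borel_measurable gaussian_seq"
  proof -
    \<comment> \<open>A shift of coordinate \<open>k\<close> is a resampling whose new value
      \<open>x k + c\<close> depends on the sequence itself.\<close>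
    have [measurable]: "(\<lambda>x. x(k := x k + c)) \<in> gaussian_seq \<rightarrow>\<^sub>M gaussian_seq" for c
    proof -
      have "(\<lambda>x. (x k + c, x)) \<in> gaussian_seq \<rightarrow>\<^sub>M borel \<Otimes>\<^sub>M gaussian_seq" by measurable
      then have "(\<lambda>x. (x k + c, x)) \<in> gaussian_seq \<rightarrow>\<^sub>M std_normal \<Otimes>\<^sub>M gaussian_seq"
        by (simp cong: measurable_cong_sets sets_pair_measure_cong add: sets_std_normal)
      from measurable_compose[OF this measurable_resample_seq[of k]] show ?thesis by simp
    qed
    show ?thesis unfolding dA_def[abs_def] by measurable
  qed
  obtain C where C: "0 \<le> C" "\<And>y. \<bar>f y\<bar> \<le> C" "\<And>y w. \<bar>blinfun_apply (f' y) w\<bar> \<le> C * norm w"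
    using C1_bounded_obtain[OF f] by metis
  have FC: "\<bar>F x\<bar> \<le> C" for x unfolding F_def by (rule C(2))
  have F'C: "\<bar>F' x\<bar> \<le> C * ((1 + T) * (\<integral>s. \<bar>gT_dot e T k s\<bar> \<partial>lebesgue_on {0..T}))" for x
    unfolding F'_def
    using T_pos C(1) brownian_path_measurable[OF basis T_pos] gT_dot_integrable[OF basis T_pos]
    by (intro order_trans[OF C(3)] mult_left_mono norm_malliavin_derivative_le) auto
  define q where "q \<omega> = A (\<lambda>l. \<xi> l \<omega>) * \<xi> k \<omega> - partial_deriv k A (\<lambda>l. \<xi> l \<omega>)" for \<omega>
  \<comment> \<open>Measurable counterpart of \<open>q\<close> on the sequence space; the two agree
    almost surely along \<open>\<xi>\<close>.\<close>
  define Q where "Q x = A x * x k - dA x" for x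
  have [measurable]: "Q \<in> borel_measurable gaussian_seq" unfolding Q_def[abs_def] by measurable
  have dA_eq: "dA x = D" if "((\<lambda>s. A (x(k := s))) has_field_derivative D) (at (x k))" for x D
    using limI[OF has_field_derivative_imp_difference_quotient_LIMSEQ[OF that]] by (simp add: dA_def)
  have Qq: "AE \<omega> in M. Q (\<lambda>l. \<xi> l \<omega>) = q \<omega>"
    using diff
  proof eventually_elim
    case (elim \<omega>)
    let ?x = "\<lambda>l. \<xi> l \<omega>"
    have "((\<lambda>s. A (?x(k := s))) has_field_derivative partial_deriv k A ?x) (at (?x k))"
      using elim unfolding partial_deriv_def by (simp add: DERIV_deriv_iff_field_differentiable)
    then have "dA ?x = partial_deriv k A ?x" by (rule dA_eq)
    then show ?case by (simp add: Q_def q_def)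
  qed
  have Q\<xi>: "(\<lambda>\<omega>. Q (\<lambda>l. \<xi> l \<omega>)) \<in> borel_measurable M" "(\<lambda>\<omega>. F (\<lambda>l. \<xi> l \<omega>)) \<in> borel_measurable M"
    by (rule measurable_compose[OF \<xi>(1)], measurable)+
  have qint: "integrable M q" using int(2) by (simp add: q_def[abs_def])
  have Aint: "integrable gaussian_seq A"
    using integrable_distr_eq[OF \<xi>(1), of A] int(1) unfolding \<xi>(2) by simp
  have Qint: "integrable gaussian_seq Q"
    using integrable_distr_eq[OF \<xi>(1), of Q] integrable_cong_AE[OF Q\<xi>(1) borel_measurable_integrable[OF qint] Qq] qint
    unfolding \<xi>(2) by simp
  have AF': "integrable gaussian_seq (\<lambda>x. A x * F' x)"
    by (rule integrable_mult_bounded[OF Aint _ F'C]) measurable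
  have QF: "integrable gaussian_seq (\<lambda>x. Q x * F x)"
    by (rule integrable_mult_bounded[OF Qint _ FC]) measurable
  define R where "R x = Q x * F x - A x * F' x" for x
  have Rint: "integrable gaussian_seq R" unfolding R_def[abs_def] using AF' QF by simp
  have [measurable]: "R \<in> borel_measurable gaussian_seq" using Rint by auto
  have "AE \<omega> in M. (\<integral>s. R ((\<lambda>l. \<xi> l \<omega>)(k := s)) \<partial>std_normal) = 0"
  proof -
    \<comment> \<open>From the sequence space to \<open>M\<close>, almost sure statements pass for
      arbitrary \<open>P\<close>. The converse direction requires a measurable event.\<close>
    have AE_transfer: "AE \<omega> in M. P (\<lambda>l. \<xi> l \<omega>)" if "AE x in gaussian_seq. P x" for P
      by (rule AE_distrD[OF \<xi>(1)]) (unfold \<xi>(2), fact that)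
    have 1: "AE \<omega> in M. brownian_converges e T (\<lambda>l. \<xi> l \<omega>)"
      by (rule AE_transfer[OF AE_brownian_converges[OF basis T_pos]])
    have 2: "AE \<omega> in M. integrable std_normal (\<lambda>s. A ((\<lambda>l. \<xi> l \<omega>)(k := s)))"
      by (rule AE_transfer[OF AE_integrable_resample[OF Aint]])
    have 3: "AE \<omega> in M. integrable std_normal (\<lambda>s. Q ((\<lambda>l. \<xi> l \<omega>)(k := s)))"
      by (rule AE_transfer[OF AE_integrable_resample[OF Qint]])
    from 1 2 3 diff show ?thesis
    proof eventually_elim
      case (elim \<omega>)
      define x where "x = (\<lambda>l. \<xi> l \<omega>)"
      define a where "a s = A (x(k := s))" for s
      have a: "(a has_field_derivative deriv a s) (at s)" for s
        using elim(4) by (simp add: a_def[abs_def] x_def DERIV_deriv_iff_field_differentiable)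
      \<comment> \<open>Differentiability along the whole \<open>k\<close>-th line is used: the
        resampled value \<open>s\<close> is arbitrary and not the observed
        \<open>\<xi> k \<omega>\<close>.\<close>
      have Qa: "Q (x(k := s)) = a s * s - deriv a s" for s
        using dA_eq[of "x(k := s)" "deriv a s"] a[of s] by (simp add: Q_def a_def[abs_def])
      have "(\<integral>s. (a s * s - deriv a s) * F (x(k := s)) - a s * F' (x(k := s)) \<partial>std_normal) = 0"
        unfolding F_def F'_def
        by (rule resampled_integration_by_parts[OF basis T_pos f _ a])
          (use elim in \<open>simp_all add: x_def[symmetric] Qa a_def[symmetric]\<close>)
      then show ?case by (simp add: R_def Qa a_def x_def[symmetric])
    qed
  qed
  moreover have "(\<lambda>x. \<integral>s. R (x(k := s)) \<partial>std_normal) \<in> borel_measurable gaussian_seq"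
  proof (rule std_normal.borel_measurable_lebesgue_integral)
    have "(\<lambda>p. R ((snd p)(k := fst p))) \<in> borel_measurable (std_normal \<Otimes>\<^sub>M gaussian_seq)"
      using measurable_compose[OF measurable_resample_seq[of k], of R borel] by (simp add: case_prod_beta')
    from measurable_compose[OF measurable_pair_swap' this]
    show "(\<lambda>(x, s). R (x(k := s))) \<in> borel_measurable (gaussian_seq \<Otimes>\<^sub>M std_normal)"
      by (simp add: case_prod_beta')
  qed
  then have "{x \<in> space gaussian_seq. (\<integral>s. R (x(k := s)) \<partial>std_normal) = 0} \<in> sets gaussian_seq" by measurable
  \<comment> \<open>Return to the sequence space, licensed by the measurability of the resampled
    integral just shown.\<close>
  ultimately have "AE x in gaussian_seq. (\<integral>s. R (x(k := s)) \<partial>std_normal) = 0"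
    using AE_distr_iff[OF \<xi>(1), of "\<lambda>x. (\<integral>s. R (x(k := s)) \<partial>std_normal) = 0"] unfolding \<xi>(2) by simp
  then have "(\<integral>x. (\<integral>s. R (x(k := s)) \<partial>std_normal) \<partial>gaussian_seq) = 0"
    by (rule integral_eq_zero_AE)
  then have "(\<integral>x. R x \<partial>gaussian_seq) = 0" using integral_resample[OF Rint] by simp
  then have eq: "(\<integral>x. Q x * F x \<partial>gaussian_seq) = (\<integral>x. A x * F' x \<partial>gaussian_seq)"
    using AF' QF by (simp add: R_def)
  have transfer: "(\<integral>x. G x \<partial>gaussian_seq) = (\<integral>\<omega>. G (\<lambda>l. \<xi> l \<omega>) \<partial>M)"
    if "G \<in> borel_measurable gaussian_seq" for G :: "(nat \<Rightarrow> real) \<Rightarrow> real"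
    using integral_distr[OF \<xi>(1) that] unfolding \<xi>(2) by simp
  have "(\<integral>\<omega>. q \<omega> * f (X \<omega>) \<partial>M) = (\<integral>\<omega>. Q (\<lambda>l. \<xi> l \<omega>) * F (\<lambda>l. \<xi> l \<omega>) \<partial>M)"
  proof (rule integral_cong_AE)
    show "AE \<omega> in M. q \<omega> * f (X \<omega>) = Q (\<lambda>l. \<xi> l \<omega>) * F (\<lambda>l. \<xi> l \<omega>)"
      using Qq by eventually_elim (simp add: F_def X_def)
    show "(\<lambda>\<omega>. q \<omega> * f (X \<omega>)) \<in> borel_measurable M"
      using borel_measurable_times[OF borel_measurable_integrable[OF qint] Q\<xi>(2)] by (simp add: F_def X_def)
  qed (use Q\<xi> in measurable)
  also have "\<dots> = (\<integral>\<omega>. A (\<lambda>l. \<xi> l \<omega>) * F' (\<lambda>l. \<xi> l \<omega>) \<partial>M)"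
    using eq by (simp add: transfer)
  finally show "(\<integral>\<omega>. (A (\<lambda>l. \<xi> l \<omega>) * \<xi> k \<omega> - partial_deriv k A (\<lambda>l. \<xi> l \<omega>)) * f (X \<omega>) \<partial>M) =
      (\<integral>\<omega>. A (\<lambda>l. \<xi> l \<omega>) * blinfun_apply (f' (X \<omega>)) (DX \<omega>) \<partial>M)"
    by (simp add: q_def F'_def X_def DX_def)
  show "integrable M (\<lambda>\<omega>. A (\<lambda>l. \<xi> l \<omega>) * blinfun_apply (f' (X \<omega>)) (DX \<omega>))"
    using integrable_distr_eq[OF \<xi>(1), of "\<lambda>x. A x * F' x"] AF' unfolding \<xi>(2) by (simp add: F'_def X_def DX_def)
qed

section \<open>Summation over the coordinates\<close>

lemma kinetic_bm_cong:
  "0 \<le> T \<Longrightarrow> (\<And>t. t \<in> {0..T} \<Longrightarrow> b t = b' t) \<Longrightarrow> kinetic_bm u z b T = kinetic_bm u z b' T"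
  by (auto simp: kinetic_bm_def intro!: Bochner_Integration.integral_cong)

lemma malliavin_derivative_cong:
  "(\<And>t. t \<in> {0..T} \<Longrightarrow> b t = b' t) \<Longrightarrow> malliavin_derivative u b T \<phi> = malliavin_derivative u b' T \<phi>"
  by (auto simp: malliavin_derivative_def intro!: Bochner_Integration.integral_cong)

text \<open>Polarization: distances from \<open>h \<omega>\<close> to \<open>\<phi>\<close> and to 0
  are measurable by definition and determine the inner product.\<close>

lemma L1_L2_random_variable_inner_measurable:
  assumes h: "L1_L2_random_variable M T h" and \<phi>: "\<phi> \<in> L2 T"
  shows "(\<lambda>\<omega>. L2_inner T (h \<omega>) \<phi>) \<in> borel_measurable M"
proof -
  have zero: "(\<lambda>t. 0) \<in> L2 T" by (simp add: L2_def)
  have [measurable]: "(\<lambda>\<omega>. L2_norm T (\<lambda>t. h \<omega> t - \<phi> t)) \<in> borel_measurable M"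
    "(\<lambda>\<omega>. L2_norm T (h \<omega>)) \<in> borel_measurable M"
    using h \<phi> zero by (auto simp: L1_L2_random_variable_def)
  have eq: "L2_inner T (h \<omega>) \<phi> =
      ((L2_norm T (h \<omega>))\<^sup>2 + (L2_norm T \<phi>)\<^sup>2 - (L2_norm T (\<lambda>t. h \<omega> t - \<phi> t))\<^sup>2) / 2"
    if "\<omega> \<in> space M" for \<omega>
    using L2_norm_diff_power2[of "h \<omega>" T \<phi>] h \<phi> that by (simp add: L1_L2_random_variable_def)
  show ?thesis by (subst measurable_cong[OF eq]) simp_all
qed

lemma distr_independent_std_normals:
  assumes "prob_space M" "prob_space.indep_vars M (\<lambda>_. borel) \<xi> (UNIV :: nat set)"
    "\<And>k. distributed M lborel (\<xi> k) (\<lambda>x. ennreal (std_normal_density x))"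
  shows "(\<lambda>\<omega> l. \<xi> l \<omega>) \<in> M \<rightarrow>\<^sub>M gaussian_seq"
    and "distr M gaussian_seq (\<lambda>\<omega> l. \<xi> l \<omega>) = gaussian_seq"
proof -
  interpret prob_space M by fact
  have \<xi>: "\<xi> k \<in> borel_measurable M" for k
    using distributed_measurable[OF assms(3)[of k]] by simp
  have d: "distr M borel (\<xi> k) = std_normal" for k
  proof -
    have "distr M borel (\<xi> k) = distr M lborel (\<xi> k)" by (rule distr_cong) auto
    also have "\<dots> = std_normal"
      using distributed_distr_eq_density[OF assms(3)[of k]] by (simp add: std_normal_def)
    finally show ?thesis .
  qed
  show m: "(\<lambda>\<omega> l. \<xi> l \<omega>) \<in> M \<rightarrow>\<^sub>M gaussian_seq"
    using measurable_PiM_single'[of UNIV \<xi> M "\<lambda>_. borel"] \<xi>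
    by (simp cong: measurable_cong_sets add: sets_gaussian_seq)
  have "distr M (\<Pi>\<^sub>M i\<in>UNIV. borel) (\<lambda>\<omega>. \<lambda>i\<in>UNIV. \<xi> i \<omega>) = (\<Pi>\<^sub>M i\<in>UNIV. distr M borel (\<xi> i))"
    using indep_vars_iff_distr_eq_PiM[where I=UNIV and M'="\<lambda>_. borel" and X=\<xi>] \<xi> assms(2) by simp
  then have "distr M (Pi\<^sub>M UNIV (\<lambda>_. borel)) (\<lambda>\<omega> l. \<xi> l \<omega>) = gaussian_seq"
    by (simp add: d gaussian_seq_def restrict_UNIV)
  moreover have "distr M gaussian_seq (\<lambda>\<omega> l. \<xi> l \<omega>) = distr M (Pi\<^sub>M UNIV (\<lambda>_. borel)) (\<lambda>\<omega> l. \<xi> l \<omega>)"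
    by (rule distr_cong) (simp_all add: sets_gaussian_seq)
  ultimately show "distr M gaussian_seq (\<lambda>\<omega> l. \<xi> l \<omega>) = gaussian_seq" by simp
qed

theorem proposition2p2:
  fixes M :: "'a measure" and \<xi> :: "nat \<Rightarrow> 'a \<Rightarrow> real" and e :: "nat \<Rightarrow> real \<Rightarrow> real"
    and T u :: real and z :: complex
    and B :: "real \<Rightarrow> 'a \<Rightarrow> real"
    and h :: "'a \<Rightarrow> real \<Rightarrow> real"
    and A :: "nat \<Rightarrow> (nat \<Rightarrow> real) \<Rightarrow> real" and \<alpha> :: "nat \<Rightarrow> 'a \<Rightarrow> real"
    and dh :: "'a \<Rightarrow> real"
    and f :: "real \<times> complex \<Rightarrow> real"
    and f' :: "real \<times> complex \<Rightarrow> (real \<times> complex) \<Rightarrow>\<^sub>L real"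
  assumes "prob_space M"
    and "prob_space.indep_vars M (\<lambda>_. borel) \<xi> UNIV"
    and "\<And>k. distributed M lborel (\<xi> k) (\<lambda>x. ennreal (std_normal_density x))"
    and "L2_orthonormal_basis 1 e"
    and "\<And>t. t \<in> {0..1} \<Longrightarrow> e 0 t = 1"
    and "T > 0"
    and "\<And>t \<omega>. t \<in> {0..T} \<Longrightarrow> B t \<omega> = (\<Sum>k. gT e T k t * \<xi> k \<omega>)"
    and "L1_L2_random_variable M T h"
    and "\<And>k. A k \<in> borel_measurable (Pi\<^sub>M UNIV (\<lambda>_. borel))"
    and "\<And>k \<omega>. \<alpha> k \<omega> = A k (\<lambda>l. \<xi> l \<omega>)"
    and "AE \<omega> in M. L2_sums T (\<lambda>k t. \<alpha> k \<omega> * gT_dot e T k t) (h \<omega>)"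
    and "\<And>K k. k \<le> K \<Longrightarrow>
           AE \<omega> in M. gaussian_integrable_with_derivative K (freeze_tail K (A k) (\<lambda>l. \<xi> l \<omega>))"
    and "L1_sums M (\<lambda>k \<omega>. \<alpha> k \<omega> * \<xi> k \<omega> - partial_deriv k (A k) (\<lambda>l. \<xi> l \<omega>)) dh"
    and "C1_bounded f f'"
  shows "let X = \<lambda>\<omega>. kinetic_bm u z (\<lambda>t. B t \<omega>) T;
             DX = \<lambda>\<omega>. malliavin_derivative u (\<lambda>t. B t \<omega>) T (h \<omega>)
         in integrable M (\<lambda>\<omega>. blinfun_apply (f' (X \<omega>)) (DX \<omega>)) \<and>
            integrable M (\<lambda>\<omega>. f (X \<omega>) * dh \<omega>) \<and>
            (\<integral>\<omega>. blinfun_apply (f' (X \<omega>)) (DX \<omega>) \<partial>M) = (\<integral>\<omega>. f (X \<omega>) * dh \<omega> \<partial>M)"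
proof -
  interpret prob_space M by fact
  note basis = \<open>L2_orthonormal_basis 1 e\<close> and T_pos = \<open>T > 0\<close> and f = \<open>C1_bounded f f'\<close>
    and h = \<open>L1_L2_random_variable M T h\<close> and \<alpha> = assms(10)
  note \<xi> = distr_independent_std_normals[OF assms(1-3)]
  note orth = gT_dot_orthonormal[OF basis T_pos]
  note \<phi>_L2 = gT_dot_L2[OF basis T_pos] and \<phi>_int = gT_dot_integrable[OF basis T_pos]
  define b where "b \<omega> = brownian e T (\<lambda>l. \<xi> l \<omega>)" for \<omega>
  define X where "X \<omega> = kinetic_bm u z (b \<omega>) T" for \<omega>
  define DX where "DX \<omega> = malliavin_derivative u (b \<omega>) T" for \<omega>
  define L where "L \<omega> \<phi> = blinfun_apply (f' (X \<omega>)) (DX \<omega> \<phi>)" for \<omega> \<phi>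
  define d where "d k \<omega> = \<alpha> k \<omega> * \<xi> k \<omega> - partial_deriv k (A k) (\<lambda>l. \<xi> l \<omega>)" for k \<omega>
  have \<xi>_meas: "\<xi> k \<in> borel_measurable M" for k
    using measurable_compose[OF \<xi>(1) measurable_gaussian_seq_component(2)[of k]] .
  have b_path: "b \<omega> \<in> borel_measurable (lebesgue_on {0..T})" for \<omega>
    unfolding b_def by (rule brownian_path_measurable[OF basis T_pos])
  have joint: "(\<lambda>(\<omega>, t). b \<omega> t) \<in> borel_measurable (M \<Otimes>\<^sub>M lebesgue_on {0..T})"
    unfolding b_def by (rule brownian_measurable_pair[OF basis T_pos \<xi>_meas])
  have X_meas: "X \<in> borel_measurable M"
    unfolding X_def[abs_def]
    by (intro measurable_kinetic_bm joint) (simp add: b_def brownian_measurable[OF basis T_pos] \<xi>_meas)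
  obtain C where C: "0 \<le> C" "\<And>y. \<bar>f y\<bar> \<le> C" "\<And>y w. \<bar>blinfun_apply (f' y) w\<bar> \<le> C * norm w"
    using C1_bounded_obtain[OF f] by metis
  have hL2: "h \<omega> \<in> L2 T" if "\<omega> \<in> space M" for \<omega>
    using h that by (simp add: L1_L2_random_variable_def)
  have h_int: "integrable M (\<lambda>\<omega>. L2_norm T (h \<omega>))"
    using h by (simp add: L1_L2_random_variable_def)

  \<comment> \<open>\<open>C\<close> bounds the derivative of \<open>f\<close>, \<open>1 + T\<close>
    bounds the Malliavin derivative by the L1 norm of the direction, and \<open>sqrt T\<close>
    passes from the L1 to the L2 norm.\<close>
  define K where "K = C * ((1 + T) * sqrt T)"
  have "0 \<le> K" using C(1) T_pos by (simp add: K_def)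
  have L_bound: "\<bar>L \<omega> \<phi>\<bar> \<le> K * L2_norm T \<phi>" if "\<phi> \<in> L2 T" for \<omega> \<phi>
  proof -
    have "\<bar>L \<omega> \<phi>\<bar> \<le> C * norm (DX \<omega> \<phi>)" unfolding L_def by (rule C(3))
    also have "\<dots> \<le> C * ((1 + T) * (\<integral>s. \<bar>\<phi> s\<bar> \<partial>lebesgue_on {0..T}))"
      unfolding DX_def using T_pos C(1) b_path L2_integrable[OF that]
      by (intro mult_left_mono norm_malliavin_derivative_le) auto
    also have "\<dots> \<le> C * ((1 + T) * (sqrt T * L2_norm T \<phi>))"
      using T_pos C(1) L2_integral_abs_le[OF that] by (intro mult_left_mono) auto
    finally show ?thesis by (simp add: K_def mult_ac)
  qed
  have L_diff: "L \<omega> (\<lambda>t. \<phi> t - \<psi> t) = L \<omega> \<phi> - L \<omega> \<psi>" if "\<phi> \<in> L2 T" "\<psi> \<in> L2 T" for \<omega> \<phi> \<psi>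
    using malliavin_derivative_diff[OF b_path _ L2_integrable[OF that(1)] L2_integrable[OF that(2)]] T_pos
    by (simp add: L_def DX_def blinfun.diff_right)
  define S where "S n \<omega> t = (\<Sum>k<n. \<alpha> k \<omega> * gT_dot e T k t)" for n \<omega> t
  have S_L2: "S n \<omega> \<in> L2 T" for n \<omega>
    unfolding S_def[abs_def] by (intro L2_sum L2_cmult \<phi>_L2)
  have L_S: "L \<omega> (S n \<omega>) = (\<Sum>k<n. \<alpha> k \<omega> * L \<omega> (gT_dot e T k))" for n \<omega>
    using malliavin_derivative_sum[OF b_path _ \<phi>_int, where u=u and c="\<lambda>k. \<alpha> k \<omega>" and n=n] T_pos
    by (simp add: L_def DX_def S_def[abs_def] blinfun.sum_right blinfun.scaleR_right)
  have L_h_meas: "(\<lambda>\<omega>. L \<omega> (h \<omega>)) \<in> borel_measurable M"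
    unfolding L_def DX_def
  proof (intro C1_bounded_measurable(2)[OF f X_meas] measurable_malliavin_derivative[OF joint])
    fix t assume "t \<in> {0..T}"
    then show "(\<lambda>\<omega>. \<integral>s. h \<omega> s \<partial>lebesgue_on {0..t}) \<in> borel_measurable M"
      using L1_L2_random_variable_inner_measurable[OF h L2_indicator[of "{0..t}"]]
      by (simp add: L2_integral_eq_inner[where T=T])
  qed (use hL2 L2_integrable T_pos in auto)

  have sums: "AE \<omega> in M. L2_sums T (\<lambda>k t. \<alpha> k \<omega> * gT_dot e T k t) (h \<omega>)" by fact
  have coeff: "AE \<omega> in M. \<forall>k. \<alpha> k \<omega> = L2_inner T (h \<omega>) (gT_dot e T k)"
    using sums AE_space
  proof eventually_elim
    case (elim \<omega>)
    show ?case
      using L2_sums_imp_coeff[OF orth hL2[OF elim(2)], where c="\<lambda>k. \<alpha> k \<omega>"] elim(1) by blast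
  qed
  \<comment> \<open>As a Fourier coefficient against a unit vector, \<open>\<alpha> k\<close> is
    dominated by the norm of \<open>h\<close>, which is integrable over \<open>M\<close>.\<close>
  have \<alpha>_int: "integrable M (\<alpha> k)" for k
  proof (rule Bochner_Integration.integrable_bound[OF h_int])
    show "\<alpha> k \<in> borel_measurable M"
      using measurable_compose[OF \<xi>(1), of "A k" borel] assms(9)[of k]
      by (simp add: \<alpha>[abs_def] cong: measurable_cong_sets add: sets_gaussian_seq)
    have norm1: "L2_norm T (gT_dot e T k) = 1" using orth by (simp add: L2_norm_def L2_orthonormal_def)
    show "AE \<omega> in M. norm (\<alpha> k \<omega>) \<le> norm (L2_norm T (h \<omega>))"
      using coeff AE_space
    proof eventually_elim
      case (elim \<omega>)
      then show ?case using L2_Cauchy_Schwarz[OF hL2[of \<omega>] \<phi>_L2[of k]] norm1 by simp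
    qed
  qed
  have d_int: "integrable M (d k)" for k
    using assms(13) by (simp add: L1_sums_def d_def[abs_def])
  have dh_int: "integrable M dh" using assms(13) by (simp add: L1_sums_def)

  have diff: "AE \<omega> in M. \<forall>r. (\<lambda>s. A k ((\<lambda>l. \<xi> l \<omega>)(k := s))) field_differentiable (at r)" for k
    using assms(12)[of k k, OF order_refl]
  proof eventually_elim
    case (elim \<omega>)
    show ?case
    proof
      fix r
      \<comment> \<open>The hypothesis with \<open>K = k\<close>, at the point whose last coordinate
        is \<open>r\<close>. The value \<open>undefined\<close> beyond \<open>k\<close> puts the
        point in the extensional space; \<open>freeze_tail\<close> reads the tail from
        \<open>\<xi>\<close> instead.\<close>
      let ?x = "\<lambda>l. if l \<le> k then (if l = k then r else \<xi> l \<omega>) else undefined"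
      have "?x \<in> {..k} \<rightarrow>\<^sub>E UNIV" by (auto simp: PiE_def extensional_def)
      then have "(\<lambda>s. freeze_tail k (A k) (\<lambda>l. \<xi> l \<omega>) (?x(k := s))) field_differentiable (at (?x k))"
        using elim unfolding gaussian_integrable_with_derivative_def by blast
      moreover have "freeze_tail k (A k) (\<lambda>l. \<xi> l \<omega>) (?x(k := s)) = A k ((\<lambda>l. \<xi> l \<omega>)(k := s))" for s
        unfolding freeze_tail_def by (rule arg_cong[where f="A k"]) (auto simp: fun_eq_iff)
      ultimately show "(\<lambda>s. A k ((\<lambda>l. \<xi> l \<omega>)(k := s))) field_differentiable (at r)" by simp
    qed
  qed
  have comp: "integrable M (\<lambda>\<omega>. \<alpha> k \<omega> * L \<omega> (gT_dot e T k))"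
      "(\<integral>\<omega>. d k \<omega> * f (X \<omega>) \<partial>M) = (\<integral>\<omega>. \<alpha> k \<omega> * L \<omega> (gT_dot e T k) \<partial>M)" for k
    using integration_by_parts_component[OF basis T_pos f \<xi> assms(9) diff, of k u z] \<alpha>_int[of k] d_int[of k]
    by (simp_all add: \<alpha>[abs_def] d_def[abs_def] L_def X_def DX_def b_def)
  have fX_meas: "(\<lambda>\<omega>. f (X \<omega>)) \<in> borel_measurable M"
    by (rule measurable_compose[OF X_meas C1_bounded_measurable(1)[OF f]])
  have df_int: "integrable M (\<lambda>\<omega>. d k \<omega> * f (X \<omega>))" for k
    by (rule integrable_mult_bounded[OF d_int fX_meas C(2)])
  have dhf_int: "integrable M (\<lambda>\<omega>. dh \<omega> * f (X \<omega>))"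
    by (rule integrable_mult_bounded[OF dh_int fX_meas C(2)])
  have partial: "(\<integral>\<omega>. (\<Sum>k<n. d k \<omega>) * f (X \<omega>) \<partial>M) = (\<integral>\<omega>. L \<omega> (S n \<omega>) \<partial>M)" for n
    using comp df_int by (simp add: sum_distrib_right L_S)

  have "(\<lambda>n. (\<integral>\<omega>. (\<Sum>k<n. d k \<omega>) * f (X \<omega>) \<partial>M) - (\<integral>\<omega>. dh \<omega> * f (X \<omega>) \<partial>M)) \<longlonglongrightarrow> 0"
  proof (rule Lim_null_comparison)
    have "(\<lambda>n. \<integral>\<omega>. \<bar>dh \<omega> - (\<Sum>k<n. d k \<omega>)\<bar> \<partial>M) \<longlonglongrightarrow> 0"
      using assms(13) by (simp add: L1_sums_def d_def[abs_def])
    then show "(\<lambda>n. C * (\<integral>\<omega>. \<bar>dh \<omega> - (\<Sum>k<n. d k \<omega>)\<bar> \<partial>M)) \<longlonglongrightarrow> 0"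
      by (rule tendsto_mult_right_zero)
    have "norm ((\<integral>\<omega>. (\<Sum>k<n. d k \<omega>) * f (X \<omega>) \<partial>M) - (\<integral>\<omega>. dh \<omega> * f (X \<omega>) \<partial>M))
        \<le> C * (\<integral>\<omega>. \<bar>dh \<omega> - (\<Sum>k<n. d k \<omega>)\<bar> \<partial>M)" for n
    proof -
      let ?D = "\<lambda>\<omega>. dh \<omega> - (\<Sum>k<n. d k \<omega>)"
      have D: "integrable M ?D" using dh_int d_int by simp
      have Df: "integrable M (\<lambda>\<omega>. ?D \<omega> * f (X \<omega>))"
        by (rule integrable_mult_bounded[OF D fX_meas C(2)])
      have "(\<integral>\<omega>. (\<Sum>k<n. d k \<omega>) * f (X \<omega>) \<partial>M) - (\<integral>\<omega>. dh \<omega> * f (X \<omega>) \<partial>M)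
          = - (\<integral>\<omega>. ?D \<omega> * f (X \<omega>) \<partial>M)"
        using df_int dhf_int by (simp add: left_diff_distrib sum_distrib_right)
      also have "\<bar>\<dots>\<bar> \<le> (\<integral>\<omega>. \<bar>?D \<omega> * f (X \<omega>)\<bar> \<partial>M)" by simp
      also have "\<dots> \<le> (\<integral>\<omega>. C * \<bar>?D \<omega>\<bar> \<partial>M)"
      proof (rule integral_mono)
        show "\<bar>?D \<omega> * f (X \<omega>)\<bar> \<le> C * \<bar>?D \<omega>\<bar>" for \<omega>
          using mult_right_mono[OF C(2)[of "X \<omega>"], of "\<bar>?D \<omega>\<bar>"] by (simp add: abs_mult mult.commute)
      qed (rule integrable_abs[OF Df], rule integrable_mult_right[OF integrable_abs[OF D]])
      finally show ?thesis by simp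
    qed
    then show "\<forall>\<^sub>F n in sequentially. norm ((\<integral>\<omega>. (\<Sum>k<n. d k \<omega>) * f (X \<omega>) \<partial>M) - (\<integral>\<omega>. dh \<omega> * f (X \<omega>) \<partial>M))
        \<le> C * (\<integral>\<omega>. \<bar>dh \<omega> - (\<Sum>k<n. d k \<omega>)\<bar> \<partial>M)" by simp
  qed
  then have lim1: "(\<lambda>n. \<integral>\<omega>. L \<omega> (S n \<omega>) \<partial>M) \<longlonglongrightarrow> (\<integral>\<omega>. dh \<omega> * f (X \<omega>) \<partial>M)"
    by (simp add: partial LIM_zero_iff)

  have S_meas: "(\<lambda>\<omega>. L \<omega> (S n \<omega>)) \<in> borel_measurable M" for n
    unfolding L_S using comp(1) by (intro borel_measurable_sum) auto
  have lim_ae: "AE \<omega> in M. (\<lambda>n. L \<omega> (S n \<omega>)) \<longlonglongrightarrow> L \<omega> (h \<omega>)"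
    using sums AE_space
  proof eventually_elim
    case (elim \<omega>)
    have "(\<lambda>n. L2_norm T (\<lambda>t. h \<omega> t - S n \<omega> t)) \<longlonglongrightarrow> 0"
      using elim(1) by (simp add: L2_sums_def S_def)
    then have "(\<lambda>n. K * L2_norm T (\<lambda>t. h \<omega> t - S n \<omega> t)) \<longlonglongrightarrow> 0"
      by (rule tendsto_mult_right_zero)
    moreover have "norm (L \<omega> (S n \<omega>) - L \<omega> (h \<omega>)) \<le> K * L2_norm T (\<lambda>t. h \<omega> t - S n \<omega> t)" for n
      using L_bound[OF L2_diff[OF hL2[OF elim(2)] S_L2], of \<omega> n \<omega>] L_diff[OF hL2[OF elim(2)] S_L2, of \<omega> n \<omega>]
      by (simp add: abs_minus_commute)
    ultimately have "(\<lambda>n. L \<omega> (S n \<omega>) - L \<omega> (h \<omega>)) \<longlonglongrightarrow> 0"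
      by (rule Lim_null_comparison[rotated, OF _ always_eventually[OF allI]])
    then show ?case by (simp add: LIM_zero_iff)
  qed
  have dom: "AE \<omega> in M. norm (L \<omega> (S n \<omega>)) \<le> K * L2_norm T (h \<omega>)" for n
    using coeff AE_space
  proof eventually_elim
    case (elim \<omega>)
    have "(L2_norm T (S n \<omega>))\<^sup>2 = (\<Sum>k<n. (L2_inner T (h \<omega>) (gT_dot e T k))\<^sup>2)"
      using L2_norm_orthonormal_sum[OF orth, of "\<lambda>k. \<alpha> k \<omega>" n] elim(1) by (simp add: S_def[abs_def])
    also have "\<dots> \<le> (L2_norm T (h \<omega>))\<^sup>2" by (rule L2_Bessel[OF orth hL2[OF elim(2)]])
    finally have "L2_norm T (S n \<omega>) \<le> L2_norm T (h \<omega>)" by (rule power2_le_imp_le) simp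
    then show ?case
      using L_bound[OF S_L2, of \<omega> n \<omega>] mult_left_mono[OF _ \<open>0 \<le> K\<close>] by fastforce
  qed
  have w_int: "integrable M (\<lambda>\<omega>. K * L2_norm T (h \<omega>))" using h_int by simp
  have L_h_int: "integrable M (\<lambda>\<omega>. L \<omega> (h \<omega>))"
    by (rule integrable_dominated_convergence[OF L_h_meas S_meas w_int lim_ae dom])
  have lim2: "(\<lambda>n. \<integral>\<omega>. L \<omega> (S n \<omega>) \<partial>M) \<longlonglongrightarrow> (\<integral>\<omega>. L \<omega> (h \<omega>) \<partial>M)"
    by (rule integral_dominated_convergence[OF L_h_meas S_meas w_int lim_ae dom])
  have eq: "(\<integral>\<omega>. L \<omega> (h \<omega>) \<partial>M) = (\<integral>\<omega>. f (X \<omega>) * dh \<omega> \<partial>M)"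
    using LIMSEQ_unique[OF lim2 lim1] by (simp add: mult.commute)

  \<comment> \<open>\<open>B\<close> is prescribed on \<open>{0..T}\<close>; the congruence lemmas
    show that \<open>X\<close> and \<open>DX\<close> depend on these times alone.\<close>
  have Bb: "B t \<omega> = b \<omega> t" if "t \<in> {0..T}" for t \<omega>
    using assms(7)[OF that] by (simp add: b_def brownian_def)
  have "kinetic_bm u z (\<lambda>t. B t \<omega>) T = X \<omega>" for \<omega>
    unfolding X_def using T_pos Bb by (intro kinetic_bm_cong) auto
  moreover have "malliavin_derivative u (\<lambda>t. B t \<omega>) T (h \<omega>) = DX \<omega> (h \<omega>)" for \<omega>
    unfolding DX_def using Bb by (intro malliavin_derivative_cong) auto
  ultimately show ?thesis
    using L_h_int dhf_int eq by (simp add: L_def mult.commute)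
qed

end
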